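(* Let $\mathcal{A}$ be an abelian category, let $P\colon\mathcal{A}\to\mathcal{A}$ be a generating functor with a Nakayama functor $\nu$ relative to $P$, let $\nu^-$ be the right adjoint of $\nu$, and let $I:=\nu\circ P$. The following holds: (1) $\mathcal{GP}_P(\mathcal{A})$ is a resolving subcategory of $\mathcal{A}$; (2) $\mathcal{GI}_I(\mathcal{A})$ is a coresolving subcategory of $\mathcal{A}$.
   Context: All categories are preadditive, all functors additive, all subcategories full. A functor $P\colon\mathcal{A}\to\mathcal{A}$ is generating if for every $A\in\mathcal{A}$ there are $A'\in\mathcal{A}$ and an epimorphism $P(A')\to A$. A Nakayama functor relative to a generating functor $P$ is a functor $\nu\colon\mathcal{A}\to\mathcal{A}$ with a right adjoint $\nu^-$ such that (i) $\nu\circ P$ is right adjoint to $P$; (ii) the unit $\lambda\colon 1_{\mathcal{A}}\to\nu^-\circ\nu$ is an isomorphism on all objects $P(A)$, $A\in\mathcal{A}$. An object is $P$-projective (resp. $I$-injective) if it is a direct summand of some $P(A')$ (resp. $I(A')$). $\mathcal{GP}_P(\mathcal{A})$ consists of the Gorenstein $P$-projective objects: those $A$ for which there is an exact sequence $A_\bullet=\cdots\to A_1\xrightarrow{s_1}A_0\xrightarrow{s_0}A_{-1}\to\cdots$ (indexed by $\mathbb{Z}$) with all $A_i$ $P$-projective, with $\nu(A_\bullet)$ exact, and with $\operatorname{Ker}s_0=A$. $\mathcal{GI}_I(\mathcal{A})$ consists of the Gorenstein $I$-injective objects: those $A$ for which there is an exact sequence $A_\bullet$ indexed by $\mathbb{Z}$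 with all $A_i$ $I$-injective, with $\nu^-(A_\bullet)$ exact, and with $\operatorname{Ker}s_0=A$. A subcategory $\mathcal{X}$ is resolving if every object of $\mathcal{A}$ is a quotient of an object of $\mathcal{X}$ and $\mathcal{X}$ is closed under direct summands, extensions, and kernels of epimorphisms (between objects of $\mathcal{X}$). It is coresolving if every object of $\mathcal{A}$ is a subobject of an object of $\mathcal{X}$ and $\mathcal{X}$ is closed under direct summands, extensions, and cokernels of monomorphisms (between objects of $\mathcal{X}$). *)

theory Defs
  imports "HOL-Algebra.Group"
begin

section \<open>Preadditive and abelian categories\<close>

text \<open>
  Every arrow knows its source and target, so distinct hom-sets are disjoint.  The operations
  are only meaningful on composable (\<open>Comp\<close>) or parallel (\<open>Plus\<close>) arrows of the
  category; nothing is assumed about their values elsewhere.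
\<close>

record ('o, 'm) precategory =
  Obj :: "'o set"
  Arr :: "'m set"
  Src :: "'m \<Rightarrow> 'o"
  Tgt :: "'m \<Rightarrow> 'o"
  Ident :: "'o \<Rightarrow> 'm"
  Comp :: "'m \<Rightarrow> 'm \<Rightarrow> 'm" (infixl "\<cdot>\<index>" 70)
  Plus :: "'m \<Rightarrow> 'm \<Rightarrow> 'm" (infixl "\<boxplus>\<index>" 65)
  Zero :: "'o \<Rightarrow> 'o \<Rightarrow> 'm"

definition Hom :: "('o, 'm) precategory \<Rightarrow> 'o \<Rightarrow> 'o \<Rightarrow> 'm set" where
  "Hom C A B = {f \<in> Arr C. Src C f = A \<and> Tgt C f = B}"

definition hom_group :: "('o, 'm) precategory \<Rightarrow> 'o \<Rightarrow> 'o \<Rightarrow> 'm monoid" where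
  "hom_group C A B = \<lparr>carrier = Hom C A B, mult = Plus C, one = Zero C A B\<rparr>"

locale preadditive_category =
  fixes C :: "('o, 'm) precategory" (structure)
  assumes Src_in_Obj: "f \<in> Arr C \<Longrightarrow> Src C f \<in> Obj C"
    and Tgt_in_Obj: "f \<in> Arr C \<Longrightarrow> Tgt C f \<in> Obj C"
    and Ident_in_Hom: "A \<in> Obj C \<Longrightarrow> Ident C A \<in> Hom C A A"
    and Comp_in_Hom: "f \<in> Hom C A B \<Longrightarrow> g \<in> Hom C B D \<Longrightarrow> g \<cdot> f \<in> Hom C A D"
    and Comp_Ident: "f \<in> Hom C A B \<Longrightarrow> f \<cdot> Ident C A = f"
    and Ident_Comp: "f \<in> Hom C A B \<Longrightarrow> Ident C B \<cdot> f = f"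
    and Comp_assoc:
      "f \<in> Hom C A B \<Longrightarrow> g \<in> Hom C B D \<Longrightarrow> h \<in> Hom C D E \<Longrightarrow> h \<cdot> (g \<cdot> f) = (h \<cdot> g) \<cdot> f"
    and hom_comm_group: "A \<in> Obj C \<Longrightarrow> B \<in> Obj C \<Longrightarrow> comm_group (hom_group C A B)"
    and Comp_Plus:
      "f \<in> Hom C A B \<Longrightarrow> f' \<in> Hom C A B \<Longrightarrow> g \<in> Hom C B D \<Longrightarrow>
        g \<cdot> (f \<boxplus> f') = (g \<cdot> f) \<boxplus> (g \<cdot> f')"
    and Plus_Comp:
      "f \<in> Hom C A B \<Longrightarrow> g \<in> Hom C B D \<Longrightarrow> g' \<in> Hom C B D \<Longrightarrow>
        (g \<boxplus> g') \<cdot> f = (g \<cdot> f) \<boxplus> (g' \<cdot> f)"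

definition mono_arr :: "('o, 'm) precategory \<Rightarrow> 'm \<Rightarrow> bool" where
  "mono_arr C f \<longleftrightarrow> f \<in> Arr C \<and>
    (\<forall>A. \<forall>g \<in> Hom C A (Src C f). \<forall>h \<in> Hom C A (Src C f).
      f \<cdot>\<^bsub>C\<^esub> g = f \<cdot>\<^bsub>C\<^esub> h \<longrightarrow> g = h)"

definition epi_arr :: "('o, 'm) precategory \<Rightarrow> 'm \<Rightarrow> bool" where
  "epi_arr C f \<longleftrightarrow> f \<in> Arr C \<and>
    (\<forall>B. \<forall>g \<in> Hom C (Tgt C f) B. \<forall>h \<in> Hom C (Tgt C f) B.
      g \<cdot>\<^bsub>C\<^esub> f = h \<cdot>\<^bsub>C\<^esub> f \<longrightarrow> g = h)"

definition iso_arr :: "('o, 'm) precategory \<Rightarrow> 'm \<Rightarrow> bool" where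
  "iso_arr C f \<longleftrightarrow> f \<in> Arr C \<and>
    (\<exists>g \<in> Hom C (Tgt C f) (Src C f).
      g \<cdot>\<^bsub>C\<^esub> f = Ident C (Src C f) \<and> f \<cdot>\<^bsub>C\<^esub> g = Ident C (Tgt C f))"

definition zero_object :: "('o, 'm) precategory \<Rightarrow> 'o \<Rightarrow> bool" where
  "zero_object C Z \<longleftrightarrow> Z \<in> Obj C \<and>
    (\<forall>A \<in> Obj C. (\<exists>!f. f \<in> Hom C A Z) \<and> (\<exists>!f. f \<in> Hom C Z A))"

definition is_kernel :: "('o, 'm) precategory \<Rightarrow> 'm \<Rightarrow> 'm \<Rightarrow> bool" where
  "is_kernel C k f \<longleftrightarrow> k \<in> Arr C \<and> f \<in> Arr C \<and> Tgt C k = Src C f \<and>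
    f \<cdot>\<^bsub>C\<^esub> k = Zero C (Src C k) (Tgt C f) \<and>
    (\<forall>A. \<forall>h \<in> Hom C A (Src C f). f \<cdot>\<^bsub>C\<^esub> h = Zero C A (Tgt C f) \<longrightarrow>
      (\<exists>!u. u \<in> Hom C A (Src C k) \<and> k \<cdot>\<^bsub>C\<^esub> u = h))"

definition is_cokernel :: "('o, 'm) precategory \<Rightarrow> 'm \<Rightarrow> 'm \<Rightarrow> bool" where
  "is_cokernel C q f \<longleftrightarrow> q \<in> Arr C \<and> f \<in> Arr C \<and> Src C q = Tgt C f \<and>
    q \<cdot>\<^bsub>C\<^esub> f = Zero C (Src C f) (Tgt C q) \<and>
    (\<forall>B. \<forall>h \<in> Hom C (Tgt C f) B. h \<cdot>\<^bsub>C\<^esub> f = Zero C (Src C f) B \<longrightarrow>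
      (\<exists>!u. u \<in> Hom C (Tgt C q) B \<and> u \<cdot>\<^bsub>C\<^esub> q = h))"

definition is_biproduct ::
  "('o, 'm) precategory \<Rightarrow> 'o \<Rightarrow> 'o \<Rightarrow> 'o \<Rightarrow> 'm \<Rightarrow> 'm \<Rightarrow> 'm \<Rightarrow> 'm \<Rightarrow> bool" where
  "is_biproduct C S A B i j p q \<longleftrightarrow>
    i \<in> Hom C A S \<and> j \<in> Hom C B S \<and> p \<in> Hom C S A \<and> q \<in> Hom C S B \<and>
    p \<cdot>\<^bsub>C\<^esub> i = Ident C A \<and> q \<cdot>\<^bsub>C\<^esub> j = Ident C B \<and>
    p \<cdot>\<^bsub>C\<^esub> j = Zero C B A \<and> q \<cdot>\<^bsub>C\<^esub> i = Zero C A B \<and>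
    (i \<cdot>\<^bsub>C\<^esub> p) \<boxplus>\<^bsub>C\<^esub> (j \<cdot>\<^bsub>C\<^esub> q) = Ident C S"

locale abelian_category = preadditive_category C for C :: "('o, 'm) precategory" (structure) +
  assumes zero_object_exists: "\<exists>Z. zero_object C Z"
    and biproduct_exists:
      "A \<in> Obj C \<Longrightarrow> B \<in> Obj C \<Longrightarrow> \<exists>S i j p q. is_biproduct C S A B i j p q"
    and kernel_exists: "f \<in> Arr C \<Longrightarrow> \<exists>k. is_kernel C k f"
    and cokernel_exists: "f \<in> Arr C \<Longrightarrow> \<exists>q. is_cokernel C q f"
    and mono_is_kernel: "mono_arr C m \<Longrightarrow> \<exists>f. is_kernel C m f"
    and epi_is_cokernel: "epi_arr C e \<Longrightarrow> \<exists>f. is_cokernel C e f"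

definition direct_summand :: "('o, 'm) precategory \<Rightarrow> 'o \<Rightarrow> 'o \<Rightarrow> bool" where
  "direct_summand C A S \<longleftrightarrow> (\<exists>B \<in> Obj C. \<exists>i j p q. is_biproduct C S A B i j p q)"

section \<open>Exactness\<close>

definition is_image :: "('o, 'm) precategory \<Rightarrow> 'm \<Rightarrow> 'm \<Rightarrow> bool" where
  "is_image C m f \<longleftrightarrow> (\<exists>q. is_cokernel C q f \<and> is_kernel C m q)"

text \<open>\<open>exact_at C f g\<close> says that \<open>Im f = Ker g\<close> as subobjects of \<open>Tgt C f = Src C g\<close>.\<close>

definition exact_at :: "('o, 'm) precategory \<Rightarrow> 'm \<Rightarrow> 'm \<Rightarrow> bool" where
  "exact_at C f g \<longleftrightarrow> (\<exists>m. is_image C m f \<and> is_kernel C m g)"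

definition short_exact :: "('o, 'm) precategory \<Rightarrow> 'm \<Rightarrow> 'm \<Rightarrow> bool" where
  "short_exact C f g \<longleftrightarrow> mono_arr C f \<and> exact_at C f g \<and> epi_arr C g"

text \<open>
  A sequence indexed by the integers is given by its arrows \<open>s i : A\<^sub>i \<rightarrow> A\<^sub>i\<^sub>-\<^sub>1\<close>, so the object
  \<open>A\<^sub>i\<close> is \<open>Src C (s i)\<close>; consecutive arrows are composable by \<open>exact_at\<close>.
\<close>

definition exact_sequence :: "('o, 'm) precategory \<Rightarrow> (int \<Rightarrow> 'm) \<Rightarrow> bool" where
  "exact_sequence C s \<longleftrightarrow> (\<forall>i. exact_at C (s (i + 1)) (s i))"

section \<open>Additive endofunctors and adjunctions\<close>

record ('o, 'm) endofunctor =
  omap :: "'o \<Rightarrow> 'o"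
  amap :: "'m \<Rightarrow> 'm"

definition id_functor :: "('o, 'm) endofunctor" where
  "id_functor = \<lparr>omap = id, amap = id\<rparr>"

definition comp_functor ::
  "('o, 'm) endofunctor \<Rightarrow> ('o, 'm) endofunctor \<Rightarrow> ('o, 'm) endofunctor" (infixl "\<circ>\<^sub>F" 55) where
  "G \<circ>\<^sub>F F = \<lparr>omap = omap G \<circ> omap F, amap = amap G \<circ> amap F\<rparr>"

definition additive_functor :: "('o, 'm) precategory \<Rightarrow> ('o, 'm) endofunctor \<Rightarrow> bool" where
  "additive_functor C F \<longleftrightarrow>
    (\<forall>A \<in> Obj C. omap F A \<in> Obj C) \<and>
    (\<forall>A B. \<forall>f \<in> Hom C A B. amap F f \<in> Hom C (omap F A) (omap F B)) \<and>
    (\<forall>A \<in> Obj C. amap F (Ident C A) = Ident C (omap F A)) \<and>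
    (\<forall>A B D. \<forall>f \<in> Hom C A B. \<forall>g \<in> Hom C B D.
      amap F (g \<cdot>\<^bsub>C\<^esub> f) = amap F g \<cdot>\<^bsub>C\<^esub> amap F f) \<and>
    (\<forall>A B. \<forall>f \<in> Hom C A B. \<forall>g \<in> Hom C A B.
      amap F (f \<boxplus>\<^bsub>C\<^esub> g) = amap F f \<boxplus>\<^bsub>C\<^esub> amap F g)"

definition natural_transformation ::
  "('o, 'm) precategory \<Rightarrow> ('o, 'm) endofunctor \<Rightarrow> ('o, 'm) endofunctor \<Rightarrow> ('o \<Rightarrow> 'm) \<Rightarrow> bool" where
  "natural_transformation C F G \<tau> \<longleftrightarrow>
    (\<forall>A \<in> Obj C. \<tau> A \<in> Hom C (omap F A) (omap G A)) \<and>
    (\<forall>A B. \<forall>f \<in> Hom C A B. \<tau> B \<cdot>\<^bsub>C\<^esub> amap F f = amap G f \<cdot>\<^bsub>C\<^esub> \<tau> A)"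

text \<open>\<open>F\<close> is left adjoint to \<open>G\<close>, with unit \<open>\<eta>\<close> and counit \<open>\<epsilon>\<close>.\<close>

definition adjunction ::
  "('o, 'm) precategory \<Rightarrow> ('o, 'm) endofunctor \<Rightarrow> ('o, 'm) endofunctor \<Rightarrow>
    ('o \<Rightarrow> 'm) \<Rightarrow> ('o \<Rightarrow> 'm) \<Rightarrow> bool" where
  "adjunction C F G \<eta> \<epsilon> \<longleftrightarrow>
    additive_functor C F \<and> additive_functor C G \<and>
    natural_transformation C id_functor (G \<circ>\<^sub>F F) \<eta> \<and>
    natural_transformation C (F \<circ>\<^sub>F G) id_functor \<epsilon> \<and>
    (\<forall>A \<in> Obj C. \<epsilon> (omap F A) \<cdot>\<^bsub>C\<^esub> amap F (\<eta> A) = Ident C (omap F A)) \<and>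
    (\<forall>A \<in> Obj C. amap G (\<epsilon> A) \<cdot>\<^bsub>C\<^esub> \<eta> (omap G A) = Ident C (omap G A))"

definition right_adjoint_to ::
  "('o, 'm) precategory \<Rightarrow> ('o, 'm) endofunctor \<Rightarrow> ('o, 'm) endofunctor \<Rightarrow> bool" where
  "right_adjoint_to C G F \<longleftrightarrow> (\<exists>\<eta> \<epsilon>. adjunction C F G \<eta> \<epsilon>)"

section \<open>Nakayama functors and Gorenstein objects\<close>

definition generating_functor :: "('o, 'm) precategory \<Rightarrow> ('o, 'm) endofunctor \<Rightarrow> bool" where
  "generating_functor C P \<longleftrightarrow> additive_functor C P \<and>
    (\<forall>A \<in> Obj C. \<exists>A' \<in> Obj C. \<exists>f \<in> Hom C (omap P A') A. epi_arr C f)"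

text \<open>
  The chosen right adjoint \<open>\<nu>'\<close> (the functor \<open>\<nu>\<^sup>-\<close>) and the unit \<open>\<lambda>\<close> (here \<open>\<eta>\<close>) and counit of
  the chosen adjunction are part of the data.
\<close>

definition nakayama_functor ::
  "('o, 'm) precategory \<Rightarrow> ('o, 'm) endofunctor \<Rightarrow> ('o, 'm) endofunctor \<Rightarrow>
    ('o, 'm) endofunctor \<Rightarrow> ('o \<Rightarrow> 'm) \<Rightarrow> ('o \<Rightarrow> 'm) \<Rightarrow> bool" where
  "nakayama_functor C P \<nu> \<nu>' \<eta> \<epsilon> \<longleftrightarrow>
    adjunction C \<nu> \<nu>' \<eta> \<epsilon> \<and>
    right_adjoint_to C (\<nu> \<circ>\<^sub>F P) P \<and>
    (\<forall>A \<in> Obj C. iso_arr C (\<eta> (omap P A)))"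

definition relative_projective :: "('o, 'm) precategory \<Rightarrow> ('o, 'm) endofunctor \<Rightarrow> 'o \<Rightarrow> bool" where
  "relative_projective C P X \<longleftrightarrow> (\<exists>A \<in> Obj C. direct_summand C X (omap P A))"

definition relative_injective :: "('o, 'm) precategory \<Rightarrow> ('o, 'm) endofunctor \<Rightarrow> 'o \<Rightarrow> bool" where
  "relative_injective C I X \<longleftrightarrow> (\<exists>A \<in> Obj C. direct_summand C X (omap I A))"

text \<open>
  A full subcategory is represented by its set of objects.  The condition \<open>Ker s\<^sub>0 = A\<close> is read
  as: \<open>A\<close> is the domain of some kernel of \<open>s 0\<close>, kernels being determined up to isomorphism.
\<close>

definition gorenstein_projectives ::
  "('o, 'm) precategory \<Rightarrow> ('o, 'm) endofunctor \<Rightarrow> ('o, 'm) endofunctor \<Rightarrow> 'o set" where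
  "gorenstein_projectives C P \<nu> = {A \<in> Obj C. \<exists>s.
    exact_sequence C s \<and> (\<forall>i. relative_projective C P (Src C (s i))) \<and>
    exact_sequence C (\<lambda>i. amap \<nu> (s i)) \<and>
    (\<exists>k. is_kernel C k (s 0) \<and> Src C k = A)}"

definition gorenstein_injectives ::
  "('o, 'm) precategory \<Rightarrow> ('o, 'm) endofunctor \<Rightarrow> ('o, 'm) endofunctor \<Rightarrow> 'o set" where
  "gorenstein_injectives C I \<nu>' = {A \<in> Obj C. \<exists>s.
    exact_sequence C s \<and> (\<forall>i. relative_injective C I (Src C (s i))) \<and>
    exact_sequence C (\<lambda>i. amap \<nu>' (s i)) \<and>
    (\<exists>k. is_kernel C k (s 0) \<and> Src C k = A)}"

section \<open>Resolving and coresolving subcategories\<close>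

definition closed_under_summands :: "('o, 'm) precategory \<Rightarrow> 'o set \<Rightarrow> bool" where
  "closed_under_summands C X \<longleftrightarrow> (\<forall>S \<in> X. \<forall>A. direct_summand C A S \<longrightarrow> A \<in> X)"

definition closed_under_extensions :: "('o, 'm) precategory \<Rightarrow> 'o set \<Rightarrow> bool" where
  "closed_under_extensions C X \<longleftrightarrow>
    (\<forall>f g. short_exact C f g \<and> Src C f \<in> X \<and> Tgt C g \<in> X \<longrightarrow> Tgt C f \<in> X)"

definition resolving :: "('o, 'm) precategory \<Rightarrow> 'o set \<Rightarrow> bool" where
  "resolving C X \<longleftrightarrow> X \<subseteq> Obj C \<and>
    (\<forall>A \<in> Obj C. \<exists>B \<in> X. \<exists>f \<in> Hom C B A. epi_arr C f) \<and>
    closed_under_summands C X \<and> closed_under_extensions C X \<and>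
    (\<forall>f k. epi_arr C f \<and> Src C f \<in> X \<and> Tgt C f \<in> X \<and> is_kernel C k f \<longrightarrow> Src C k \<in> X)"

definition coresolving :: "('o, 'm) precategory \<Rightarrow> 'o set \<Rightarrow> bool" where
  "coresolving C X \<longleftrightarrow> X \<subseteq> Obj C \<and>
    (\<forall>A \<in> Obj C. \<exists>B \<in> X. \<exists>f \<in> Hom C A B. mono_arr C f) \<and>
    closed_under_summands C X \<and> closed_under_extensions C X \<and>
    (\<forall>f q. mono_arr C f \<and> Src C f \<in> X \<and> Tgt C f \<in> X \<and> is_cokernel C q f \<longrightarrow> Tgt C q \<in> X)"

end

theory Submission
  imports Defs
begin

text \<open>
  Put \<open>S = P \<circ> \<nu>\<close> and \<open>I = \<nu> \<circ> P\<close>.  Since the unit of \<open>\<nu> \<stileturn> \<nu>'\<close> is invertible on the objects \<open>P A\<close>, the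
  functor \<open>\<nu>' \<circ> \<nu> \<circ> P\<close> is isomorphic to \<open>P\<close>, and composing the adjunctions \<open>\<nu> \<stileturn> \<nu>'\<close> and \<open>P \<stileturn> I\<close> gives
  \<open>S \<stileturn> P \<stileturn> I\<close>.  Both adjunctions have the same counit \<open>T A \<rightarrow> A\<close>, where \<open>T = S \<circ> P = P \<circ> I\<close>
  (\<open>adj_P_\<nu>\<close>).  The counit is epi because \<open>P\<close> is generating; hence \<open>P\<close> is faithful.  Now \<open>P\<close> is a left and
  a right adjoint, and \<open>I\<close> is a right adjoint and a composite of left adjoints; so \<open>P\<close> and \<open>I\<close> are exact,
  and with them \<open>T\<close> and \<open>S \<circ> T = P \<circ> I \<circ> I\<close>.  Being faithful and exact, \<open>P\<close> preserves and reflects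
  monomorphisms, so the right exact functors \<open>\<nu>\<close> and \<open>S\<close> are exact on the same short exact sequences, and \<open>S\<close> may replace \<open>\<nu>\<close>.

  The syzygy \<open>syz A\<close> is the kernel of \<open>T A \<rightarrow> A\<close>, and the cosyzygy \<open>cosyz A\<close> is the cokernel of the
  unit \<open>A \<rightarrow> P (S A)\<close>.  An object \<open>A\<close> is Gorenstein projective iff two conditions hold
  (\<open>gorenstein_projectives_eq\<close>): \<open>S\<close> preserves the monomorphism \<open>syz B \<rightarrow> T B\<close> for all iterated
  syzygies \<open>B\<close> of \<open>A\<close>, including \<open>A\<close> itself, which is the vanishing of the higher left derived functors
  of \<open>S\<close> at \<open>A\<close>; and the unit is mono at \<open>A\<close> and all its iterated cosyzygies.  Under these conditions the syzygies and cosyzygies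
  splice to a complete resolution of \<open>A\<close> (\<open>complete_resolution\<close>); and any complete resolution forces
  the conditions, by coinduction along its cycles (\<open>resolved_S_acyclic\<close>, \<open>coresolved_embedded\<close>).

  Both conditions are coinductive and expressed through functorial constructions, so all closure
  properties follow from the fact that syzygies and cosyzygies of a short exact sequence form short
  exact sequences (\<open>syz_of_ses\<close>, \<open>cosyz_of_ses\<close>; the second needs \<open>S\<close> to be exact on the given
  sequence), together with pieces of the snake lemma.

  The second statement is the first one for the opposite category: there \<open>I\<close> is generating, and \<open>\<nu>'\<close>
  is a Nakayama functor relative to \<open>I\<close>, because \<open>\<nu>' \<circ> I\<close> is isomorphic to the left adjoint \<open>P\<close> of \<open>I\<close>
  (\<open>nakayama_opposite\<close>).
\<close>

section \<open>Preadditive categories\<close>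

context preadditive_category
begin

lemma Src_Obj [simp]: "f \<in> Arr C \<Longrightarrow> Src C f \<in> Obj C"
  and Tgt_Obj [simp]: "f \<in> Arr C \<Longrightarrow> Tgt C f \<in> Obj C"
  by (auto intro: Src_in_Obj Tgt_in_Obj)

lemma Comp_arr:
  assumes "f \<in> Arr C" "g \<in> Arr C" "Src C g = Tgt C f"
  shows "g \<cdot> f \<in> Arr C" "Src C (g \<cdot> f) = Src C f" "Tgt C (g \<cdot> f) = Tgt C g"
  using Comp_in_Hom[of f "Src C f" "Tgt C f" g "Tgt C g"] assms by (auto simp: Hom_def)

lemma Ident_arr:
  assumes "A \<in> Obj C"
  shows "Ident C A \<in> Arr C" "Src C (Ident C A) = A" "Tgt C (Ident C A) = A"
  using Ident_in_Hom[OF assms] by (auto simp: Hom_def)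

lemmas arr_simps [simp] = Comp_arr Ident_arr

lemma Comp_Comp [simp]:
  assumes "f \<in> Arr C" "g \<in> Arr C" "h \<in> Arr C" "Src C g = Tgt C f" "Src C h = Tgt C g"
  shows "(h \<cdot> g) \<cdot> f = h \<cdot> (g \<cdot> f)"
  using Comp_assoc[of f "Src C f" "Tgt C f" g "Tgt C g" h "Tgt C h"] assms by (auto simp: Hom_def)

text \<open>
  Composites are normalised to right-nested form, where an equation \<open>g \<cdot> f = \<dots>\<close> no longer matches
  when \<open>f\<close> is composed on the right with another arrow.  The next two lemmas provide that form.
\<close>

lemma Comp_eq_Comp:
  assumes "g \<cdot> f = g' \<cdot> f'"
    and "f \<in> Arr C" "g \<in> Arr C" "Src C g = Tgt C f"
    and "f' \<in> Arr C" "g' \<in> Arr C" "Src C g' = Tgt C f'"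
    and "x \<in> Arr C" "Tgt C x = Src C f"
  shows "g \<cdot> (f \<cdot> x) = g' \<cdot> (f' \<cdot> x)"
proof -
  have "Src C f' = Src C f"
    using assms by (metis Comp_arr(2))
  then have "g \<cdot> (f \<cdot> x) = (g \<cdot> f) \<cdot> x" "g' \<cdot> (f' \<cdot> x) = (g' \<cdot> f') \<cdot> x"
    using assms(2-) by simp_all
  then show ?thesis
    using assms(1) by simp
qed

lemma Comp_eq:
  assumes "g \<cdot> f = k" and "f \<in> Arr C" "g \<in> Arr C" "Src C g = Tgt C f"
    and "x \<in> Arr C" "Tgt C x = Src C f"
  shows "g \<cdot> (f \<cdot> x) = k \<cdot> x"
  using assms(2-) Comp_Comp[of x f g] by (simp add: assms(1))

lemma Comp_Ident' [simp]: "f \<in> Arr C \<Longrightarrow> Src C f = A \<Longrightarrow> f \<cdot> Ident C A = f"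
  using Comp_Ident[of f A "Tgt C f"] by (auto simp: Hom_def)

lemma Ident_Comp' [simp]: "f \<in> Arr C \<Longrightarrow> Tgt C f = B \<Longrightarrow> Ident C B \<cdot> f = f"
  using Ident_Comp[of f "Src C f" B] by (auto simp: Hom_def)

subsection \<open>The group structure on the hom-sets\<close>

lemma Zero_arr [simp]:
  assumes "A \<in> Obj C" "B \<in> Obj C"
  shows "Zero C A B \<in> Arr C" "Src C (Zero C A B) = A" "Tgt C (Zero C A B) = B"
proof -
  interpret G: comm_group "hom_group C A B"
    by (rule hom_comm_group[OF assms])
  have "Zero C A B \<in> Hom C A B"
    using G.one_closed by (simp add: hom_group_def)
  then show "Zero C A B \<in> Arr C" "Src C (Zero C A B) = A" "Tgt C (Zero C A B) = B"
    by (auto simp: Hom_def)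
qed

definition Minus :: "'m \<Rightarrow> 'm \<Rightarrow> 'm" (infixl "\<boxminus>" 65) where
  "f \<boxminus> g = f \<boxplus> inv\<^bsub>hom_group C (Src C g) (Tgt C g)\<^esub> g"

lemma Plus_arr [simp]:
  assumes "f \<in> Arr C" "g \<in> Arr C" "Src C g = Src C f" "Tgt C g = Tgt C f"
  shows "f \<boxplus> g \<in> Arr C" "Src C (f \<boxplus> g) = Src C f" "Tgt C (f \<boxplus> g) = Tgt C f"
proof -
  interpret G: comm_group "hom_group C (Src C f) (Tgt C f)"
    by (rule hom_comm_group) (use assms in simp_all)
  have "f \<boxplus> g \<in> Hom C (Src C f) (Tgt C f)"
    using G.m_closed[of f g] assms by (simp add: hom_group_def Hom_def)
  then show "f \<boxplus> g \<in> Arr C" "Src C (f \<boxplus> g) = Src C f" "Tgt C (f \<boxplus> g) = Tgt C f"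
    by (auto simp: Hom_def)
qed

lemma Plus_Zero [simp]:
  assumes "f \<in> Arr C" "Src C f = A" "Tgt C f = B"
  shows "f \<boxplus> Zero C A B = f" "Zero C A B \<boxplus> f = f"
proof -
  interpret G: comm_group "hom_group C (Src C f) (Tgt C f)"
    by (rule hom_comm_group) (simp_all add: assms(1))
  show "f \<boxplus> Zero C A B = f" "Zero C A B \<boxplus> f = f"
    using G.r_one[of f] G.l_one[of f] assms by (simp_all add: hom_group_def Hom_def)
qed

lemma Plus_cancel:
  assumes "f \<in> Arr C" "g \<in> Arr C" "h \<in> Arr C"
    and "Src C g = Src C f" "Tgt C g = Tgt C f" "Src C h = Src C f" "Tgt C h = Tgt C f"
  shows "f \<boxplus> g = f \<boxplus> h \<longleftrightarrow> g = h" "g \<boxplus> f = h \<boxplus> f \<longleftrightarrow> g = h"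
proof -
  interpret G: comm_group "hom_group C (Src C f) (Tgt C f)"
    by (rule hom_comm_group) (use assms in simp_all)
  show "f \<boxplus> g = f \<boxplus> h \<longleftrightarrow> g = h" "g \<boxplus> f = h \<boxplus> f \<longleftrightarrow> g = h"
    using G.right_cancel[of f g h] G.m_comm[of f g] G.m_comm[of f h] assms by (auto simp: hom_group_def Hom_def)
qed

lemma Minus_arr [simp]:
  assumes "f \<in> Arr C" "g \<in> Arr C" "Src C g = Src C f" "Tgt C g = Tgt C f"
  shows "f \<boxminus> g \<in> Arr C" "Src C (f \<boxminus> g) = Src C f" "Tgt C (f \<boxminus> g) = Tgt C f"
    and Minus_Plus: "(f \<boxminus> g) \<boxplus> g = f"
proof -
  interpret G: comm_group "hom_group C (Src C f) (Tgt C f)"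
    by (rule hom_comm_group) (use assms in simp_all)
  have fg: "f \<in> carrier (hom_group C (Src C f) (Tgt C f))"
    "g \<in> carrier (hom_group C (Src C f) (Tgt C f))"
    using assms by (auto simp: hom_group_def Hom_def)
  have eq: "f \<boxminus> g = f \<otimes>\<^bsub>hom_group C (Src C f) (Tgt C f)\<^esub> inv\<^bsub>hom_group C (Src C f) (Tgt C f)\<^esub> g"
    using assms by (simp add: Minus_def hom_group_def)
  have "f \<boxminus> g \<in> carrier (hom_group C (Src C f) (Tgt C f))"
    unfolding eq using fg by simp
  then show "f \<boxminus> g \<in> Arr C" "Src C (f \<boxminus> g) = Src C f" "Tgt C (f \<boxminus> g) = Tgt C f"
    by (auto simp: hom_group_def Hom_def)
  have "(f \<boxminus> g) \<otimes>\<^bsub>hom_group C (Src C f) (Tgt C f)\<^esub> g = f"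
    unfolding eq using fg by (simp add: G.m_assoc)
  then show "(f \<boxminus> g) \<boxplus> g = f"
    by (simp add: hom_group_def)
qed

lemma Minus_unique:
  assumes "f \<in> Arr C" "g \<in> Arr C" "Src C g = Src C f" "Tgt C g = Tgt C f"
    and "h \<in> Arr C" "Src C h = Src C f" "Tgt C h = Tgt C f" and "h \<boxplus> g = f"
  shows "f \<boxminus> g = h"
  using assms Minus_Plus[of f g] Plus_cancel(2)[of g "f \<boxminus> g" h] by simp

lemma Comp_Plus':
  assumes "f \<in> Arr C" "f' \<in> Arr C" "Src C f' = Src C f" "Tgt C f' = Tgt C f"
    and "g \<in> Arr C" "Src C g = Tgt C f"
  shows "g \<cdot> (f \<boxplus> f') = (g \<cdot> f) \<boxplus> (g \<cdot> f')"
  using Comp_Plus[of f "Src C f" "Tgt C f" f' g "Tgt C g"] assms by (auto simp: Hom_def)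

lemma Plus_Comp':
  assumes "g \<in> Arr C" "g' \<in> Arr C" "Src C g' = Src C g" "Tgt C g' = Tgt C g"
    and "f \<in> Arr C" "Tgt C f = Src C g"
  shows "(g \<boxplus> g') \<cdot> f = (g \<cdot> f) \<boxplus> (g' \<cdot> f)"
  using Plus_Comp[of f "Src C f" "Src C g" g "Tgt C g" g'] assms by (auto simp: Hom_def)

lemma Comp_Minus:
  assumes "f \<in> Arr C" "f' \<in> Arr C" "Src C f' = Src C f" "Tgt C f' = Tgt C f"
    and "g \<in> Arr C" "Src C g = Tgt C f"
  shows "g \<cdot> (f \<boxminus> f') = (g \<cdot> f) \<boxminus> (g \<cdot> f')"
  using assms by (intro Minus_unique[symmetric]) (simp_all flip: Comp_Plus')

lemma Minus_Comp:
  assumes "g \<in> Arr C" "g' \<in> Arr C" "Src C g' = Src C g" "Tgt C g' = Tgt C g"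
    and "f \<in> Arr C" "Tgt C f = Src C g"
  shows "(g \<boxminus> g') \<cdot> f = (g \<cdot> f) \<boxminus> (g' \<cdot> f)"
  using assms by (intro Minus_unique[symmetric]) (simp_all flip: Plus_Comp')

lemma Comp_Zero [simp]:
  assumes "f \<in> Arr C" "A \<in> Obj C" "Src C f = B"
  shows "f \<cdot> Zero C A B = Zero C A (Tgt C f)"
proof -
  have "(f \<cdot> Zero C A B) \<boxplus> (f \<cdot> Zero C A B) = f \<cdot> (Zero C A B \<boxplus> Zero C A B)"
    using assms by (subst Comp_Plus') auto
  also have "\<dots> = (f \<cdot> Zero C A B) \<boxplus> Zero C A (Tgt C f)"
    using assms by (subst Plus_Zero; auto)+
  finally show ?thesis
    using assms by (subst (asm) Plus_cancel) auto
qed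

lemma Zero_Comp [simp]:
  assumes "f \<in> Arr C" "B \<in> Obj C" "Tgt C f = A"
  shows "Zero C A B \<cdot> f = Zero C (Src C f) B"
proof -
  have "(Zero C A B \<cdot> f) \<boxplus> (Zero C A B \<cdot> f) = (Zero C A B \<boxplus> Zero C A B) \<cdot> f"
    using assms by (subst Plus_Comp') auto
  also have "\<dots> = (Zero C A B \<cdot> f) \<boxplus> Zero C (Src C f) B"
    using assms by (subst Plus_Zero; auto)+
  finally show ?thesis
    using assms by (subst (asm) Plus_cancel) auto
qed

lemma Minus_eq_Zero_iff:
  assumes "f \<in> Arr C" "g \<in> Arr C" "Src C g = Src C f" "Tgt C g = Tgt C f"
    and "Src C f = A" "Tgt C f = B"
  shows "f \<boxminus> g = Zero C A B \<longleftrightarrow> f = g"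
proof
  assume "f \<boxminus> g = Zero C A B"
  then show "f = g"
    using Minus_Plus[of f g] assms by auto
next
  assume "f = g"
  then show "f \<boxminus> g = Zero C A B"
    using assms by (intro Minus_unique) auto
qed

lemma Minus_Zero [simp]:
  assumes "f \<in> Arr C" "Src C f = A" "Tgt C f = B"
  shows "f \<boxminus> Zero C A B = f"
  using assms by (intro Minus_unique) auto

subsection \<open>Monomorphisms, epimorphisms, kernels and cokernels\<close>

lemma mono_arr_iff:
  "mono_arr C f \<longleftrightarrow> f \<in> Arr C \<and> (\<forall>x \<in> Arr C. Tgt C x = Src C f \<longrightarrow>
    f \<cdot> x = Zero C (Src C x) (Tgt C f) \<longrightarrow> x = Zero C (Src C x) (Src C f))"
proof (intro iffI conjI ballI impI; (elim conjE)?)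
  assume m: "mono_arr C f"
  then show f [simp]: "f \<in> Arr C"
    by (simp add: mono_arr_def)
  fix x assume [simp]: "x \<in> Arr C" "Tgt C x = Src C f" and "f \<cdot> x = Zero C (Src C x) (Tgt C f)"
  then have "f \<cdot> x = f \<cdot> Zero C (Src C x) (Src C f)"
    by simp
  moreover have "x \<in> Hom C (Src C x) (Src C f)" "Zero C (Src C x) (Src C f) \<in> Hom C (Src C x) (Src C f)"
    by (simp_all add: Hom_def)
  ultimately show "x = Zero C (Src C x) (Src C f)"
    using m unfolding mono_arr_def by blast
next
  assume f: "f \<in> Arr C" and *: "\<forall>x \<in> Arr C. Tgt C x = Src C f \<longrightarrow>
    f \<cdot> x = Zero C (Src C x) (Tgt C f) \<longrightarrow> x = Zero C (Src C x) (Src C f)"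
  have "g = h" if "g \<in> Hom C A (Src C f)" "h \<in> Hom C A (Src C f)" "f \<cdot> g = f \<cdot> h" for A g h
  proof -
    have gh: "g \<in> Arr C" "h \<in> Arr C" "Src C h = Src C g" "Tgt C h = Tgt C g" "Tgt C g = Src C f"
      using that by (auto simp: Hom_def)
    then have "f \<cdot> (g \<boxminus> h) = Zero C (Src C g) (Tgt C f)"
      using f that(3) by (subst Comp_Minus) (auto simp: Minus_eq_Zero_iff)
    then have "g \<boxminus> h = Zero C (Src C g) (Src C f)"
      using *[rule_format, of "g \<boxminus> h"] gh by simp
    then show ?thesis
      using gh by (simp add: Minus_eq_Zero_iff)
  qed
  then show "mono_arr C f"
    using f by (auto simp: mono_arr_def)
qed

lemma mono_in_Arr: "mono_arr C f \<Longrightarrow> f \<in> Arr C"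
  and epi_in_Arr: "epi_arr C f \<Longrightarrow> f \<in> Arr C"
  by (auto simp: mono_arr_def epi_arr_def)

lemma mono_Zero:
  assumes "mono_arr C f" "x \<in> Arr C" "Tgt C x = Src C f"
    and "f \<cdot> x = Zero C (Src C x) (Tgt C f)"
  shows "x = Zero C (Src C x) (Src C f)"
  using assms by (auto simp: mono_arr_iff)

lemma mono_cancel:
  assumes "mono_arr C f" "x \<in> Arr C" "y \<in> Arr C" "Tgt C x = Src C f" "Tgt C y = Src C f"
    and "f \<cdot> x = f \<cdot> y"
  shows "x = y"
proof -
  have "Src C (f \<cdot> x) = Src C (f \<cdot> y)"
    using assms(6) by simp
  then have "Src C x = Src C y"
    using assms(2-5) mono_in_Arr[OF assms(1)] by simp
  then have "x \<in> Hom C (Src C x) (Src C f)" "y \<in> Hom C (Src C x) (Src C f)"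
    using assms by (auto simp: Hom_def)
  then show ?thesis
    using assms(1,6) unfolding mono_arr_def by blast
qed

lemma mono_left_factor:
  assumes "mono_arr C (g \<cdot> f)" "f \<in> Arr C" "g \<in> Arr C" "Src C g = Tgt C f"
  shows "mono_arr C f"
  unfolding mono_arr_iff
proof (intro conjI ballI impI)
  fix x assume x: "x \<in> Arr C" "Tgt C x = Src C f" "f \<cdot> x = Zero C (Src C x) (Tgt C f)"
  then have "(g \<cdot> f) \<cdot> x = Zero C (Src C x) (Tgt C (g \<cdot> f))"
    using assms(2-) by simp
  then show "x = Zero C (Src C x) (Src C f)"
    using mono_Zero[OF assms(1), of x] x assms(2-) by simp
qed fact

lemma mono_Comp:
  assumes "mono_arr C f" "mono_arr C g" "Src C g = Tgt C f"
  shows "mono_arr C (g \<cdot> f)"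
proof -
  have [simp]: "f \<in> Arr C" "g \<in> Arr C"
    using assms mono_in_Arr by auto
  show ?thesis
    unfolding mono_arr_iff
  proof (intro conjI ballI impI)
    fix x assume x: "x \<in> Arr C" "Tgt C x = Src C (g \<cdot> f)"
      "(g \<cdot> f) \<cdot> x = Zero C (Src C x) (Tgt C (g \<cdot> f))"
    then have "f \<cdot> x = Zero C (Src C x) (Tgt C f)"
      using mono_Zero[OF assms(2), of "f \<cdot> x"] assms(3) by simp
    then show "x = Zero C (Src C x) (Src C (g \<cdot> f))"
      using mono_Zero[OF assms(1), of x] x assms(3) by simp
  qed (use assms(3) in simp)
qed

lemma split_mono:
  assumes "r \<cdot> f = Ident C (Src C f)" "f \<in> Arr C" "r \<in> Arr C" "Src C r = Tgt C f"
  shows "mono_arr C f"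
proof (rule mono_left_factor[OF _ assms(2-4)])
  show "mono_arr C (r \<cdot> f)"
    using assms by (auto simp: mono_arr_iff)
qed

lemma is_kernelD:
  assumes "is_kernel C k f"
  shows "k \<in> Arr C" "f \<in> Arr C" "Src C f = Tgt C k" "f \<cdot> k = Zero C (Src C k) (Tgt C f)"
  using assms by (auto simp: is_kernel_def)

lemma kernel_lift:
  assumes "is_kernel C k f" "h \<in> Arr C" "Tgt C h = Src C f"
    and "f \<cdot> h = Zero C (Src C h) (Tgt C f)"
  obtains v where "v \<in> Arr C" "Src C v = Src C h" "Tgt C v = Src C k" "k \<cdot> v = h"
proof -
  have "h \<in> Hom C (Src C h) (Src C f)"
    using assms by (simp add: Hom_def)
  then obtain v where "v \<in> Hom C (Src C h) (Src C k)" "k \<cdot> v = h"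
    using assms unfolding is_kernel_def by blast
  then show thesis
    using that by (auto simp: Hom_def)
qed

lemma kernel_mono:
  assumes "is_kernel C k f"
  shows "mono_arr C k"
proof -
  note [simp] = is_kernelD[OF assms]
  show ?thesis
    unfolding mono_arr_iff
  proof (intro conjI ballI impI)
    fix x assume [simp]: "x \<in> Arr C" "Tgt C x = Src C k" and 0: "k \<cdot> x = Zero C (Src C x) (Tgt C k)"
    let ?z = "Zero C (Src C x) (Tgt C k)"
    have "?z \<in> Hom C (Src C x) (Src C f)" "f \<cdot> ?z = Zero C (Src C x) (Tgt C f)"
      by (auto simp: Hom_def)
    then have "\<exists>!u. u \<in> Hom C (Src C x) (Src C k) \<and> k \<cdot> u = ?z"
      using assms unfolding is_kernel_def by blast
    moreover have "x \<in> Hom C (Src C x) (Src C k) \<and> k \<cdot> x = ?z"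
      using 0 by (simp add: Hom_def)
    moreover have "Zero C (Src C x) (Src C k) \<in> Hom C (Src C x) (Src C k) \<and>
        k \<cdot> Zero C (Src C x) (Src C k) = ?z"
      by (simp add: Hom_def)
    ultimately show "x = Zero C (Src C x) (Src C k)"
      by blast
  qed simp
qed

lemma is_kernelI:
  assumes "mono_arr C k" "f \<in> Arr C" "Src C f = Tgt C k" "f \<cdot> k = Zero C (Src C k) (Tgt C f)"
    and "\<And>h. h \<in> Arr C \<Longrightarrow> Tgt C h = Tgt C k \<Longrightarrow> f \<cdot> h = Zero C (Src C h) (Tgt C f) \<Longrightarrow>
      \<exists>v. v \<in> Arr C \<and> Tgt C v = Src C k \<and> k \<cdot> v = h"
  shows "is_kernel C k f"
  unfolding is_kernel_def
proof (intro conjI allI ballI impI)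
  note k [simp] = mono_in_Arr[OF assms(1)]
  fix A h assume h: "h \<in> Hom C A (Src C f)" "f \<cdot> h = Zero C A (Tgt C f)"
  then obtain v where v: "v \<in> Arr C" "Tgt C v = Src C k" "k \<cdot> v = h"
    using assms(3) assms(5)[of h] by (auto simp: Hom_def)
  then have "Src C v = A"
    using h k Comp_arr(2)[of v k] by (auto simp: Hom_def)
  then show "\<exists>!u. u \<in> Hom C A (Src C k) \<and> k \<cdot> u = h"
    using v mono_cancel[OF assms(1)] by (intro ex1I[of _ v]) (auto simp: Hom_def)
qed (use assms mono_in_Arr in auto)

lemma kernel_Comp_mono:
  assumes "mono_arr C m" "p \<in> Arr C" "Src C m = Tgt C p"
  shows "is_kernel C k (m \<cdot> p) \<longleftrightarrow> is_kernel C k p"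
proof -
  note [simp] = mono_in_Arr[OF assms(1)] assms(2,3)
  have *: "m \<cdot> (p \<cdot> h) = Zero C (Src C h) (Tgt C m) \<longleftrightarrow> p \<cdot> h = Zero C (Src C h) (Tgt C p)"
    if "h \<in> Arr C" "Tgt C h = Src C p" for h
    using that mono_Zero[OF assms(1), of "p \<cdot> h"] by auto
  show ?thesis
    unfolding is_kernel_def using * by (auto simp: Hom_def)
qed

lemma zero_objectD:
  assumes "zero_object C Z"
  shows "Z \<in> Obj C" "Ident C Z = Zero C Z Z"
proof -
  show Z [simp]: "Z \<in> Obj C"
    using assms by (simp add: zero_object_def)
  have "\<exists>!f. f \<in> Hom C Z Z"
    using assms by (simp add: zero_object_def)
  moreover have "Ident C Z \<in> Hom C Z Z" "Zero C Z Z \<in> Hom C Z Z"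
    by (auto simp: Hom_def)
  ultimately show "Ident C Z = Zero C Z Z"
    by blast
qed

end

section \<open>The opposite category\<close>

text \<open>
  The notions concerning arrows, kernels and biproducts are self-dual or come in dual pairs, so a dual
  statement is obtained from its partner in the opposite category by simplification with the rules below.
\<close>

definition opposite :: "('o, 'm) precategory \<Rightarrow> ('o, 'm) precategory" where
  "opposite C = \<lparr>Obj = Obj C, Arr = Arr C, Src = Tgt C, Tgt = Src C, Ident = Ident C,
    Comp = (\<lambda>g f. f \<cdot>\<^bsub>C\<^esub> g), Plus = Plus C, Zero = (\<lambda>A B. Zero C B A)\<rparr>"

lemma opposite_simps [simp]:
  "Obj (opposite C) = Obj C" "Arr (opposite C) = Arr C"
  "Src (opposite C) = Tgt C" "Tgt (opposite C) = Src C" "Ident (opposite C) = Ident C"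
  "g \<cdot>\<^bsub>opposite C\<^esub> f = f \<cdot>\<^bsub>C\<^esub> g" "f \<boxplus>\<^bsub>opposite C\<^esub> g = f \<boxplus>\<^bsub>C\<^esub> g" "Zero (opposite C) A B = Zero C B A"
  "Hom (opposite C) A B = Hom C B A" "hom_group (opposite C) A B = hom_group C B A"
  "opposite (opposite C) = C"
  by (auto simp: opposite_def Hom_def hom_group_def)

lemma opposite_arr_simps [simp]:
  "mono_arr (opposite C) f = epi_arr C f" "epi_arr (opposite C) f = mono_arr C f"
  "iso_arr (opposite C) f = iso_arr C f"
  "is_kernel (opposite C) k f = is_cokernel C k f" "is_cokernel (opposite C) k f = is_kernel C k f"
  "zero_object (opposite C) Z = zero_object C Z"
  by (auto simp: mono_arr_def epi_arr_def iso_arr_def is_kernel_def is_cokernel_def zero_object_def)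

lemma is_biproduct_opposite [simp]:
  "is_biproduct (opposite C) S A B i j p q = is_biproduct C S A B p q i j"
  by (auto simp: is_biproduct_def)

lemma direct_summand_opposite [simp]: "direct_summand (opposite C) A S = direct_summand C A S"
  unfolding direct_summand_def is_biproduct_opposite opposite_simps by blast

lemma preadditive_opposite:
  assumes "preadditive_category C"
  shows "preadditive_category (opposite C)"
proof -
  interpret preadditive_category C by fact
  show ?thesis
    by (rule preadditive_category.intro)
      (auto intro: Ident_in_Hom Comp_in_Hom hom_comm_group
        simp: Comp_Ident Ident_Comp Comp_assoc Comp_Plus Plus_Comp)
qed

lemma abelian_opposite:
  assumes "abelian_category C"
  shows "abelian_category (opposite C)"
proof -
  interpret abelian_category C by fact
  interpret op: preadditive_category "opposite C"
    by (rule preadditive_opposite) unfold_locales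
  have "\<exists>S i j p q. is_biproduct C S A B p q i j" if "A \<in> Obj C" "B \<in> Obj C" for A B
    using biproduct_exists[OF that] by blast
  then show ?thesis
    by unfold_locales
      (auto intro: zero_object_exists kernel_exists cokernel_exists mono_is_kernel epi_is_cokernel)
qed

context preadditive_category
begin

lemmas epi_arr_iff =
  preadditive_category.mono_arr_iff[OF preadditive_opposite[OF preadditive_category_axioms], simplified]
lemmas epi_Zero =
  preadditive_category.mono_Zero[OF preadditive_opposite[OF preadditive_category_axioms], simplified]
lemmas epi_cancel =
  preadditive_category.mono_cancel[OF preadditive_opposite[OF preadditive_category_axioms], simplified]
lemmas epi_right_factor =
  preadditive_category.mono_left_factor[OF preadditive_opposite[OF preadditive_category_axioms], simplified]
lemmas epi_Comp =
  preadditive_category.mono_Comp[OF preadditive_opposite[OF preadditive_category_axioms], simplified]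
lemmas split_epi =
  preadditive_category.split_mono[OF preadditive_opposite[OF preadditive_category_axioms], simplified]
lemma is_cokernelD:
  assumes "is_cokernel C q f"
  shows "q \<in> Arr C" "f \<in> Arr C" "Src C q = Tgt C f" "q \<cdot> f = Zero C (Src C f) (Tgt C q)"
  using assms by (auto simp: is_cokernel_def)

lemmas cokernel_desc =
  preadditive_category.kernel_lift[OF preadditive_opposite[OF preadditive_category_axioms], simplified]
lemmas cokernel_epi =
  preadditive_category.kernel_mono[OF preadditive_opposite[OF preadditive_category_axioms], simplified]
lemmas is_cokernelI =
  preadditive_category.is_kernelI[OF preadditive_opposite[OF preadditive_category_axioms], simplified]
lemmas cokernel_Comp_epi =
  preadditive_category.kernel_Comp_mono[OF preadditive_opposite[OF preadditive_category_axioms], simplified]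

end

section \<open>Abelian categories: covers and short exact sequences\<close>

context abelian_category
begin

text \<open>
  An epimorphism is the cokernel of some \<open>f\<close>, and \<open>f\<close> factors through the kernel \<open>k\<close>; so whatever kills \<open>k\<close>
  kills \<open>f\<close>.
\<close>

lemma epi_cokernel_of_kernel:
  assumes "epi_arr C e" "is_kernel C k e"
  shows "is_cokernel C e k"
proof -
  note [simp] = is_kernelD[OF assms(2)]
  obtain f where f: "is_cokernel C e f"
    using epi_is_cokernel[OF assms(1)] by blast
  note [simp] = is_cokernelD(1,2,4)[OF f]
  have [simp]: "Tgt C f = Tgt C k"
    using is_cokernelD(3)[OF f] by simp
  obtain u where u: "u \<in> Arr C" "Src C u = Src C f" "Tgt C u = Src C k" "k \<cdot> u = f"
    by (rule kernel_lift[OF assms(2), of f]) simp_all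
  show ?thesis
  proof (rule is_cokernelI)
    fix h assume h: "h \<in> Arr C" "Src C h = Src C e" "h \<cdot> k = Zero C (Src C k) (Tgt C h)"
    then have "h \<cdot> f = Zero C (Src C f) (Tgt C h)"
      using u Comp_eq[of h k "Zero C (Src C k) (Tgt C h)" u] by simp
    then obtain v where "v \<in> Arr C" "Src C v = Tgt C e" "v \<cdot> e = h"
      by (rule cokernel_desc[OF f h(1), rotated]) (use h in simp_all)
    then show "\<exists>v. v \<in> Arr C \<and> Src C v = Tgt C e \<and> v \<cdot> e = h"
      by blast
  qed (use assms in simp_all)
qed

lemma mono_kernel_of_cokernel:
  assumes "mono_arr C m" "is_cokernel C q m"
  shows "is_kernel C m q"
  using abelian_category.epi_cokernel_of_kernel[OF abelian_opposite[OF abelian_category_axioms]] assms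
  by simp

text \<open>
  Generalized elements: an arrow into \<open>B\<close> is treated as an element of \<open>B\<close>, and a preimage exists
  after restriction along a cover, that is, along an epimorphism.  The reason is that
  epimorphisms are stable under pullback: \<open>e\<close> below is the projection of the pullback, which is
  the kernel of \<open>(p, -x)\<close> on the biproduct.
\<close>

lemma epi_lift:
  assumes "epi_arr C p" "x \<in> Arr C" "Tgt C x = Tgt C p"
  obtains e y where "e \<in> Arr C" "epi_arr C e" "Tgt C e = Src C x"
    "y \<in> Arr C" "Src C y = Src C e" "Tgt C y = Src C p" "x \<cdot> e = p \<cdot> y"
proof -
  note [simp] = epi_in_Arr[OF assms(1)] assms(2,3)
  obtain S i j p1 q1 where "is_biproduct C S (Src C p) (Src C x) i j p1 q1"
    using biproduct_exists[of "Src C p" "Src C x"] by auto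
  then have [simp]: "i \<in> Arr C" "Src C i = Src C p" "Tgt C i = S"
    "j \<in> Arr C" "Src C j = Src C x" "Tgt C j = S"
    "p1 \<in> Arr C" "Src C p1 = S" "Tgt C p1 = Src C p"
    "q1 \<in> Arr C" "Src C q1 = S" "Tgt C q1 = Src C x"
    and eqs [simp]: "p1 \<cdot> i = Ident C (Src C p)" "q1 \<cdot> j = Ident C (Src C x)"
    "q1 \<cdot> i = Zero C (Src C p) (Src C x)"
    by (auto simp: is_biproduct_def Hom_def)
  \<comment> \<open>The arrow \<open>d\<close> is \<open>(p, -x)\<close>; it is epi since it restricts to \<open>p\<close> along \<open>i\<close>.\<close>
  define d where "d = (p \<cdot> p1) \<boxminus> (x \<cdot> q1)"
  have d [simp]: "d \<in> Arr C" "Src C d = S" "Tgt C d = Tgt C p"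
    by (simp_all add: d_def)
  have di: "d \<cdot> i = p"
    by (simp add: d_def Minus_Comp)
  have epi_d: "epi_arr C d"
    using epi_right_factor[of d i] assms(1) by (simp add: di)
  obtain k where k: "is_kernel C k d"
    using kernel_exists[of d] by auto
  note [simp] = is_kernelD[OF k]
  have [simp]: "Tgt C k = S"
    using is_kernelD(3)[OF k] d(2) by simp
  have "(p \<cdot> p1) \<cdot> k \<boxminus> (x \<cdot> q1) \<cdot> k = Zero C (Src C k) (Tgt C p)"
    using is_kernelD(4)[OF k] by (simp add: d_def Minus_Comp)
  then have comm: "x \<cdot> (q1 \<cdot> k) = p \<cdot> (p1 \<cdot> k)"
    by (simp add: Minus_eq_Zero_iff)
  have "epi_arr C (q1 \<cdot> k)"
    unfolding epi_arr_iff
  proof (intro conjI ballI impI)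
    fix h assume h [simp]: "h \<in> Arr C" "Src C h = Tgt C (q1 \<cdot> k)"
      and "h \<cdot> (q1 \<cdot> k) = Zero C (Src C (q1 \<cdot> k)) (Tgt C h)"
    moreover have [simp]: "Src C h = Src C x"
      using h(2) by simp
    ultimately have "(h \<cdot> q1) \<cdot> k = Zero C (Src C k) (Tgt C (h \<cdot> q1))"
      by simp
    then obtain t where t [simp]: "t \<in> Arr C" "Src C t = Tgt C p" "Tgt C t = Tgt C h"
      and td: "t \<cdot> d = h \<cdot> q1"
      using cokernel_desc[OF epi_cokernel_of_kernel[OF epi_d k], of "h \<cdot> q1"] by auto
    have "t \<cdot> p = (t \<cdot> d) \<cdot> i"
      by (simp add: di)
    also have "\<dots> = Zero C (Src C p) (Tgt C t)"
      by (simp add: td)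
    finally have "t = Zero C (Tgt C p) (Tgt C t)"
      using epi_Zero[OF assms(1), of t] by simp
    then have "h \<cdot> q1 = Zero C S (Tgt C h)"
      using td Zero_Comp[of d "Tgt C t" "Tgt C p"] by simp
    then have "(h \<cdot> q1) \<cdot> j = Zero C (Src C x) (Tgt C h)"
      by simp
    then show "h = Zero C (Tgt C (q1 \<cdot> k)) (Tgt C h)"
      by simp
  qed simp
  then show thesis
    using that[of "q1 \<cdot> k" "p1 \<cdot> k"] comm by simp
qed

text \<open>
  The image of \<open>f\<close>, defined as the kernel of its cokernel, is covered by the source of \<open>f\<close>: if
  \<open>h\<close> kills \<open>p\<close>, then the image factors through the subobject \<open>m \<cdot> ker h\<close>, so \<open>ker h\<close> is split epi.
\<close>

lemma image_factor_epi:
  assumes q: "is_cokernel C q f" and m: "is_kernel C m q"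
  obtains p where "p \<in> Arr C" "Src C p = Src C f" "Tgt C p = Src C m" "m \<cdot> p = f" "epi_arr C p"
proof -
  note [simp] = is_cokernelD[OF q] is_kernelD[OF m]
  have [simp]: "Tgt C m = Tgt C f"
    using is_kernelD(3)[OF m] is_cokernelD(3)[OF q] by simp
  obtain p where p [simp]: "p \<in> Arr C" "Src C p = Src C f" "Tgt C p = Src C m" and mp: "m \<cdot> p = f"
    by (rule kernel_lift[OF m, of f]) simp_all
  have "epi_arr C p"
    unfolding epi_arr_iff
  proof (intro conjI ballI impI)
    fix h assume h [simp]: "h \<in> Arr C" "Src C h = Tgt C p"
      and hp: "h \<cdot> p = Zero C (Src C p) (Tgt C h)"
    obtain n where n: "is_kernel C n h"
      using kernel_exists[of h] by auto
    note [simp] = is_kernelD(1,2,4)[OF n]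
    have [simp]: "Tgt C n = Src C m"
      using is_kernelD(3)[OF n] by simp
    obtain p' where p' [simp]: "p' \<in> Arr C" "Src C p' = Src C f" "Tgt C p' = Src C n" and np: "n \<cdot> p' = p"
      by (rule kernel_lift[OF n, of p]) (use hp in simp_all)
    have "mono_arr C (m \<cdot> n)"
      by (rule mono_Comp[OF kernel_mono[OF n] kernel_mono[OF m]]) simp
    then obtain t where t: "is_kernel C (m \<cdot> n) t"
      using mono_is_kernel by blast
    note t' = is_kernelD[OF t]
    have [simp]: "t \<in> Arr C" "Src C t = Tgt C f"
      using t' by simp_all
    have "t \<cdot> f = (t \<cdot> (m \<cdot> n)) \<cdot> p'"
      by (simp add: np mp)
    also have "\<dots> = Zero C (Src C f) (Tgt C t)"
      by (simp add: t'(4) del: Comp_Comp)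
    finally have tf: "t \<cdot> f = Zero C (Src C f) (Tgt C t)" .
    obtain t2 where t2 [simp]: "t2 \<in> Arr C" "Src C t2 = Tgt C q" "Tgt C t2 = Tgt C t"
      and t2q: "t2 \<cdot> q = t"
      by (rule cokernel_desc[OF q _ _ tf]) simp_all
    have "t \<cdot> m = (t2 \<cdot> q) \<cdot> m"
      by (simp only: t2q)
    also have "\<dots> = Zero C (Src C m) (Tgt C t)"
      by simp
    finally have tm: "t \<cdot> m = Zero C (Src C m) (Tgt C t)" .
    obtain s where s [simp]: "s \<in> Arr C" "Src C s = Src C m" "Tgt C s = Src C n"
      and ms: "(m \<cdot> n) \<cdot> s = m"
      by (rule kernel_lift[OF t _ _ tm]) simp_all
    have ns: "n \<cdot> s = Ident C (Src C m)"
      by (rule mono_cancel[OF kernel_mono[OF m]]) (use ms in simp_all)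
    have "h = h \<cdot> (n \<cdot> s)"
      by (simp add: ns)
    also have "\<dots> = Zero C (Tgt C p) (Tgt C h)"
      by (simp add: Comp_eq[OF is_kernelD(4)[OF n]])
    finally show "h = Zero C (Tgt C p) (Tgt C h)" .
  qed simp
  then show thesis
    using that[of p] mp by simp
qed

text \<open>
  Exactness on generalized elements: what the cokernel of \<open>f\<close> kills lies in the image of \<open>f\<close>, and
  the image is covered by the source of \<open>f\<close>.
\<close>

lemma cokernel_cover:
  assumes q: "is_cokernel C q f" and x: "x \<in> Arr C" "Tgt C x = Tgt C f"
    and "q \<cdot> x = Zero C (Src C x) (Tgt C q)"
  obtains e y where "e \<in> Arr C" "epi_arr C e" "Tgt C e = Src C x"
    "y \<in> Arr C" "Src C y = Src C e" "Tgt C y = Src C f" "x \<cdot> e = f \<cdot> y"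
proof -
  note [simp] = is_cokernelD[OF q] x
  obtain m where m: "is_kernel C m q"
    using kernel_exists[of q] by auto
  note [simp] = is_kernelD(1,2,4)[OF m]
  have [simp]: "Tgt C m = Tgt C f"
    using is_kernelD(3)[OF m] by simp
  obtain p where p [simp]: "p \<in> Arr C" "Src C p = Src C f" "Tgt C p = Src C m" and mp: "m \<cdot> p = f"
    and "epi_arr C p"
    by (rule image_factor_epi[OF q m])
  obtain x' where x' [simp]: "x' \<in> Arr C" "Src C x' = Src C x" "Tgt C x' = Src C m" and mx: "m \<cdot> x' = x"
    by (rule kernel_lift[OF m, of x]) (use assms in simp_all)
  obtain e y where e [simp]: "e \<in> Arr C" "epi_arr C e" "Tgt C e = Src C x"
    "y \<in> Arr C" "Src C y = Src C e" "Tgt C y = Src C f" and xe: "x' \<cdot> e = p \<cdot> y"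
    by (rule epi_lift[OF \<open>epi_arr C p\<close>, of x']) simp_all
  have "x \<cdot> e = (m \<cdot> x') \<cdot> e"
    by (simp only: mx)
  also have "\<dots> = f \<cdot> y"
    by (simp add: xe Comp_eq[OF mp])
  finally show thesis
    using that[of e y] by simp
qed

text \<open>
  In contrast to \<^const>\<open>short_exact\<close>, this form is visibly self-dual, and it is preserved by a functor
  as soon as kernels and cokernels are.
\<close>

definition ses :: "'m \<Rightarrow> 'm \<Rightarrow> bool" where
  "ses f g \<longleftrightarrow> is_kernel C f g \<and> is_cokernel C g f"

lemma sesD:
  assumes "ses f g"
  shows "f \<in> Arr C" "g \<in> Arr C" "Src C g = Tgt C f" "g \<cdot> f = Zero C (Src C f) (Tgt C g)"
    "mono_arr C f" "epi_arr C g" "is_kernel C f g" "is_cokernel C g f"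
  using assms is_kernelD[of f g] by (auto simp: ses_def kernel_mono cokernel_epi)

lemma ses_if_epi: "is_kernel C f g \<Longrightarrow> epi_arr C g \<Longrightarrow> ses f g"
  by (simp add: ses_def epi_cokernel_of_kernel)

lemma ses_if_mono: "is_cokernel C g f \<Longrightarrow> mono_arr C f \<Longrightarrow> ses f g"
  by (simp add: ses_def mono_kernel_of_cokernel)

lemma ses_opposite: "abelian_category.ses (opposite C) f g = ses g f"
  by (auto simp: ses_def abelian_category.ses_def[OF abelian_opposite[OF abelian_category_axioms]])

lemma ses_if_short_exact:
  assumes "short_exact C f g"
  shows "ses f g"
proof -
  obtain m q where q: "is_cokernel C q f" "is_kernel C m q" and m: "is_kernel C m g"
    using assms by (auto simp: short_exact_def exact_at_def is_image_def)
  have f: "mono_arr C f" "epi_arr C g"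
    using assms by (auto simp: short_exact_def)
  have "is_cokernel C g m"
    by (rule epi_cokernel_of_kernel[OF f(2) m])
  obtain p where p: "p \<in> Arr C" "Src C p = Src C f" "Tgt C p = Src C m" "m \<cdot> p = f" "epi_arr C p"
    by (rule image_factor_epi[OF q])
  have "is_cokernel C g f"
    using cokernel_Comp_epi[of p m g] \<open>is_cokernel C g m\<close> p(3,5) is_kernelD[OF m] by (simp add: p(4))
  then show ?thesis
    by (rule ses_if_mono[OF _ f(1)])
qed

text \<open>
  The image occurring in \<^const>\<open>exact_at\<close> is one particular kernel of \<open>g\<close>; comparing it with the given
  kernel \<open>k\<close> shows that \<open>f\<close> covers every kernel of \<open>g\<close>.
\<close>

lemma exact_at_factor:
  assumes "exact_at C f g" and k: "is_kernel C k g"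
  obtains p where "p \<in> Arr C" "Src C p = Src C f" "Tgt C p = Src C k" "k \<cdot> p = f" "epi_arr C p"
proof -
  obtain m q where q: "is_cokernel C q f" "is_kernel C m q" and m: "is_kernel C m g"
    using assms(1) by (auto simp: exact_at_def is_image_def)
  note [simp] = is_kernelD(1,2,4)[OF m] is_kernelD(1,2,4)[OF k]
  have [simp]: "Src C g = Tgt C k" "Tgt C m = Tgt C k"
    using is_kernelD(3)[OF m] is_kernelD(3)[OF k] by auto
  obtain p where p [simp]: "p \<in> Arr C" "Src C p = Src C f" "Tgt C p = Src C m"
    and mp: "m \<cdot> p = f" and "epi_arr C p"
    by (rule image_factor_epi[OF q])
  obtain v where v [simp]: "v \<in> Arr C" "Src C v = Src C m" "Tgt C v = Src C k" and kv: "k \<cdot> v = m"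
    by (rule kernel_lift[OF k, of m]) simp_all
  obtain w where w [simp]: "w \<in> Arr C" "Src C w = Src C k" "Tgt C w = Src C m" and mw: "m \<cdot> w = k"
    by (rule kernel_lift[OF m, of k]) simp_all
  have "v \<cdot> w = Ident C (Src C k)"
    by (rule mono_cancel[OF kernel_mono[OF k]]) (simp_all add: Comp_eq[OF kv] mw)
  then have "epi_arr C v"
    by (intro split_epi[of v w]) simp_all
  then have "epi_arr C (v \<cdot> p)"
    using \<open>epi_arr C p\<close> by (intro epi_Comp) simp_all
  moreover have "k \<cdot> (v \<cdot> p) = f"
    by (simp add: Comp_eq[OF kv] mp)
  ultimately show thesis
    using that[of "v \<cdot> p"] by simp
qed

lemma exact_at_cover:
  assumes ex: "exact_at C f g" and x: "x \<in> Arr C" "Tgt C x = Src C g"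
    and "g \<cdot> x = Zero C (Src C x) (Tgt C g)"
  obtains e y where "e \<in> Arr C" "epi_arr C e" "Tgt C e = Src C x"
    "y \<in> Arr C" "Src C y = Src C e" "Tgt C y = Src C f" "x \<cdot> e = f \<cdot> y"
proof -
  have "g \<in> Arr C"
    using ex by (auto simp: exact_at_def is_kernel_def)
  then obtain k where k: "is_kernel C k g"
    using kernel_exists by blast
  note [simp] = is_kernelD[OF k] x(1)
  obtain p where p [simp]: "p \<in> Arr C" "Src C p = Src C f" "Tgt C p = Src C k"
    and kp: "k \<cdot> p = f" and "epi_arr C p"
    by (rule exact_at_factor[OF ex k])
  obtain x' where x' [simp]: "x' \<in> Arr C" "Src C x' = Src C x" "Tgt C x' = Src C k" and kx: "k \<cdot> x' = x"
    by (rule kernel_lift[OF k, of x]) (use assms in simp_all)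
  obtain e y where e [simp]: "e \<in> Arr C" "epi_arr C e" "Tgt C e = Src C x"
    "y \<in> Arr C" "Src C y = Src C e" "Tgt C y = Src C f" and xe: "x' \<cdot> e = p \<cdot> y"
    by (rule epi_lift[OF \<open>epi_arr C p\<close>, of x']) simp_all
  have "x \<cdot> e = (k \<cdot> x') \<cdot> e"
    by (simp only: kx)
  also have "\<dots> = f \<cdot> y"
    by (simp add: xe Comp_eq[OF kp])
  finally show thesis
    using that[of e y] by simp
qed

lemma exact_at_splice:
  assumes "ses k p" "epi_arr C q" "mono_arr C m" "Src C k = Tgt C q" "Src C m = Tgt C p"
  shows "exact_at C (k \<cdot> q) (m \<cdot> p)"
proof -
  note sesD[OF assms(1)]
  moreover have "is_cokernel C p (k \<cdot> q)"
    using assms calculation cokernel_Comp_epi[of q k p] by simp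
  moreover have "is_kernel C k (m \<cdot> p)"
    using assms calculation kernel_Comp_mono[of m p k] by simp
  ultimately show ?thesis
    unfolding exact_at_def is_image_def by blast
qed

lemma exact_at_opposite:
  assumes "exact_at C f g"
  shows "exact_at (opposite C) g f"
proof -
  obtain m q where q: "is_cokernel C q f" "is_kernel C m q" "is_kernel C m g"
    using assms by (auto simp: exact_at_def is_image_def)
  have "is_cokernel C q m"
    by (rule epi_cokernel_of_kernel[OF cokernel_epi[OF q(1)] q(2)])
  then show ?thesis
    using q unfolding exact_at_def is_image_def opposite_arr_simps by blast
qed

section \<open>Chases in a diagram with exact columns\<close>

text \<open>
  The arguments are the top, bottom, left and right side; the typing of the sides is
  part of the notion, so that the chases below need not list it.
\<close>

definition square :: "'m \<Rightarrow> 'm \<Rightarrow> 'm \<Rightarrow> 'm \<Rightarrow> bool" where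
  "square f g a b \<longleftrightarrow> f \<in> Arr C \<and> g \<in> Arr C \<and> a \<in> Arr C \<and> b \<in> Arr C \<and>
    Src C a = Src C f \<and> Tgt C a = Src C g \<and> Src C b = Tgt C f \<and> Tgt C b = Tgt C g \<and>
    b \<cdot> f = g \<cdot> a"

lemma squareD:
  assumes "square f g a b"
  shows "f \<in> Arr C" "g \<in> Arr C" "a \<in> Arr C" "b \<in> Arr C"
    "Src C a = Src C f" "Tgt C a = Src C g" "Src C b = Tgt C f" "Tgt C b = Tgt C g"
    "b \<cdot> f = g \<cdot> a"
  using assms by (auto simp: square_def)

lemma square_Comp:
  assumes "square f g a b" "x \<in> Arr C" "Tgt C x = Src C f"
  shows "b \<cdot> (f \<cdot> x) = g \<cdot> (a \<cdot> x)"
  using assms by (intro Comp_eq_Comp) (auto simp: square_def)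

lemma square_opposite:
  "abelian_category.square (opposite C) f g a b = square g f b a"
  by (auto simp: square_def abelian_category.square_def[OF abelian_opposite[OF abelian_category_axioms]])

text \<open>
  If \<open>b\<close> kills \<open>x\<close>, then \<open>c\<close> kills \<open>g1 \<cdot> x\<close>, so \<open>x\<close> comes locally from some \<open>y\<close> in the source of \<open>f1\<close>, and
  \<open>f2 \<cdot> a\<close> kills \<open>y\<close>.
\<close>

lemma four_lemma_mono:
  assumes sq: "square f1 f2 a b" "square g1 g2 b c"
    and row: "is_cokernel C g1 f1" "mono_arr C f2"
    and mono: "mono_arr C a" "mono_arr C c"
  shows "mono_arr C b"
  unfolding mono_arr_iff
proof (intro conjI ballI impI)
  note [simp] = squareD(1-8)[OF sq(1)] squareD(1-8)[OF sq(2)] is_cokernelD[OF row(1)]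
  have [simp]: "Src C g2 = Tgt C f2"
    using squareD(6)[OF sq(2)] by simp
  show "b \<in> Arr C"
    by simp
  fix x assume x [simp]: "x \<in> Arr C" "Tgt C x = Src C b" and 0: "b \<cdot> x = Zero C (Src C x) (Tgt C b)"
  have "c \<cdot> (g1 \<cdot> x) = Zero C (Src C x) (Tgt C c)"
    using 0 by (simp add: square_Comp[OF sq(2)])
  then have "g1 \<cdot> x = Zero C (Src C x) (Tgt C g1)"
    using mono_Zero[OF mono(2), of "g1 \<cdot> x"] by simp
  then have 1: "g1 \<cdot> x = Zero C (Src C x) (Tgt C g1)"
    by simp
  obtain e y where e [simp]: "e \<in> Arr C" "epi_arr C e" "Tgt C e = Src C x"
    "y \<in> Arr C" "Src C y = Src C e" "Tgt C y = Src C f1" and xe: "x \<cdot> e = f1 \<cdot> y"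
    by (rule cokernel_cover[OF row(1) _ _ 1]) simp_all
  have "f2 \<cdot> (a \<cdot> y) = b \<cdot> (x \<cdot> e)"
    by (simp add: xe square_Comp[OF sq(1)])
  also have "\<dots> = Zero C (Src C e) (Tgt C f2)"
    by (simp add: Comp_eq[OF 0])
  finally have "a \<cdot> y = Zero C (Src C e) (Tgt C a)"
    using mono_Zero[OF row(2), of "a \<cdot> y"] by simp
  then have "y = Zero C (Src C e) (Src C f1)"
    using mono_Zero[OF mono(1), of y] by simp
  then have "x \<cdot> e = Zero C (Src C e) (Src C b)"
    using xe by simp
  then show "x = Zero C (Src C x) (Src C b)"
    using epi_Zero[OF e(2), of x] by simp
qed

text \<open>
  The lemmas \<open>mono_on_cokernels\<close>, \<open>mono_on_last_column\<close> and \<open>ses_of_kernels\<close> concern a diagram with rows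
  \<open>(fi, gi)\<close> for \<open>i = 1, 2, 3\<close> and columns \<open>(a1, a2)\<close>, \<open>(b1, b2)\<close>, \<open>(c1, c2)\<close>; they are pieces of the snake
  lemma.  In \<open>mono_on_cokernels\<close>, a kernel element of \<open>f3\<close> lifts to an element \<open>y\<close> of the second row with
  \<open>f2 \<cdot> y = b1 \<cdot> z\<close>; injectivity of \<open>c1\<close> puts \<open>z\<close> into the image of \<open>f1\<close>, hence \<open>y\<close> into the image of \<open>a1\<close>.
\<close>

lemma mono_on_cokernels:
  assumes sq: "square f1 f2 a1 b1" "square g1 g2 b1 c1" "square f2 f3 a2 b2"
    and col: "is_cokernel C a2 a1" "is_cokernel C b2 b1" "mono_arr C c1"
    and row: "is_cokernel C g1 f1" "mono_arr C f2" "g2 \<cdot> f2 = Zero C (Src C f2) (Tgt C g2)"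
  shows "mono_arr C f3"
  unfolding mono_arr_iff
proof (intro conjI ballI impI)
  note [simp] = squareD(1-8)[OF sq(1)] squareD(1-8)[OF sq(2)] squareD(1-8)[OF sq(3)]
    is_cokernelD[OF col(1)] is_cokernelD[OF col(2)] is_cokernelD[OF row(1)]
  have [simp]: "Src C g2 = Tgt C f2"
    using squareD(6)[OF sq(2)] by simp
  show "f3 \<in> Arr C"
    by simp
  fix x assume x [simp]: "x \<in> Arr C" "Tgt C x = Src C f3" and 0: "f3 \<cdot> x = Zero C (Src C x) (Tgt C f3)"
  obtain e y where e [simp]: "e \<in> Arr C" "epi_arr C e" "Tgt C e = Src C x"
    "y \<in> Arr C" "Src C y = Src C e" "Tgt C y = Src C a2" and xe: "x \<cdot> e = a2 \<cdot> y"
    by (rule epi_lift[OF cokernel_epi[OF col(1)], of x]) simp_all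
  have "b2 \<cdot> (f2 \<cdot> y) = f3 \<cdot> (x \<cdot> e)"
    by (simp add: xe square_Comp[OF sq(3)])
  also have "\<dots> = Zero C (Src C (f2 \<cdot> y)) (Tgt C b2)"
    by (simp add: Comp_eq[OF 0])
  finally have 1: "b2 \<cdot> (f2 \<cdot> y) = Zero C (Src C (f2 \<cdot> y)) (Tgt C b2)" .
  obtain e' z where e' [simp]: "e' \<in> Arr C" "epi_arr C e'" "Tgt C e' = Src C e"
    "z \<in> Arr C" "Src C z = Src C e'" "Tgt C z = Src C b1" and ye: "f2 \<cdot> (y \<cdot> e') = b1 \<cdot> z"
    by (rule cokernel_cover[OF col(2) _ _ 1]) simp_all
  have "c1 \<cdot> (g1 \<cdot> z) = g2 \<cdot> (f2 \<cdot> (y \<cdot> e'))"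
    by (simp add: ye square_Comp[OF sq(2)])
  also have "\<dots> = Zero C (Src C (g1 \<cdot> z)) (Tgt C c1)"
    by (simp add: Comp_eq[OF row(3)] )
  finally have 2: "g1 \<cdot> z = Zero C (Src C z) (Tgt C g1)"
    using mono_Zero[OF col(3), of "g1 \<cdot> z"] by simp
  obtain e'' w where e'' [simp]: "e'' \<in> Arr C" "epi_arr C e''" "Tgt C e'' = Src C e'"
    "w \<in> Arr C" "Src C w = Src C e''" "Tgt C w = Src C f1" and ze: "z \<cdot> e'' = f1 \<cdot> w"
    by (rule cokernel_cover[OF row(1) _ _ 2]) simp_all
  have "f2 \<cdot> (y \<cdot> (e' \<cdot> e'')) = (f2 \<cdot> (y \<cdot> e')) \<cdot> e''"
    by simp
  also have "\<dots> = f2 \<cdot> (a1 \<cdot> w)"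
    unfolding ye by (simp add: ze square_Comp[OF sq(1)])
  finally have yw: "y \<cdot> (e' \<cdot> e'') = a1 \<cdot> w"
    by (rule mono_cancel[OF row(2), rotated 4]) simp_all
  have "x \<cdot> (e \<cdot> (e' \<cdot> e'')) = a2 \<cdot> (y \<cdot> (e' \<cdot> e''))"
    by (simp add: Comp_eq_Comp[OF xe])
  also have "\<dots> = Zero C (Src C (e \<cdot> (e' \<cdot> e''))) (Tgt C x)"
    by (simp add: yw Comp_eq[OF is_cokernelD(4)[OF col(1)]])
  finally show "x = Zero C (Src C x) (Src C f3)"
    using epi_Zero[of "e \<cdot> (e' \<cdot> e'')" x] by (simp add: epi_Comp)
qed

text \<open>
  A kernel element of \<open>c1\<close> lifts along \<open>g1\<close>, and the image of the lift in the second row comes from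
  some \<open>z\<close> along \<open>f2\<close>.  Injectivity of \<open>f3\<close> puts \<open>z\<close> into the image of \<open>a1\<close>, so the lift came from \<open>f1\<close>.
\<close>

lemma mono_on_last_column:
  assumes sq: "square f1 f2 a1 b1" "square g1 g2 b1 c1" "square f2 f3 a2 b2"
    and col: "is_cokernel C a2 a1" "mono_arr C b1" "b2 \<cdot> b1 = Zero C (Src C b1) (Tgt C b2)"
    and row: "is_cokernel C g1 f1" "is_kernel C f2 g2" "mono_arr C f3"
  shows "mono_arr C c1"
  unfolding mono_arr_iff
proof (intro conjI ballI impI)
  note [simp] = squareD(1-8)[OF sq(1)] squareD(1-8)[OF sq(2)] squareD(1-8)[OF sq(3)]
    is_cokernelD[OF col(1)] is_cokernelD[OF row(1)] is_kernelD[OF row(2)]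
  have [simp]: "Tgt C b1 = Tgt C f2"
    using squareD(6)[OF sq(2)] by simp
  show "c1 \<in> Arr C"
    by simp
  fix x assume x [simp]: "x \<in> Arr C" "Tgt C x = Src C c1" and 0: "c1 \<cdot> x = Zero C (Src C x) (Tgt C c1)"
  obtain e y where e [simp]: "e \<in> Arr C" "epi_arr C e" "Tgt C e = Src C x"
    "y \<in> Arr C" "Src C y = Src C e" "Tgt C y = Src C g1" and xe: "x \<cdot> e = g1 \<cdot> y"
    by (rule epi_lift[OF cokernel_epi[OF row(1)], of x]) simp_all
  have "g2 \<cdot> (b1 \<cdot> y) = c1 \<cdot> (x \<cdot> e)"
    by (simp add: xe square_Comp[OF sq(2)])
  also have "\<dots> = Zero C (Src C (b1 \<cdot> y)) (Tgt C g2)"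
    by (simp add: Comp_eq[OF 0])
  finally have 1: "g2 \<cdot> (b1 \<cdot> y) = Zero C (Src C (b1 \<cdot> y)) (Tgt C g2)" .
  obtain z where z [simp]: "z \<in> Arr C" "Src C z = Src C e" "Tgt C z = Src C f2" and fz: "f2 \<cdot> z = b1 \<cdot> y"
    by (rule kernel_lift[OF row(2) _ _ 1]) simp_all
  have "f3 \<cdot> (a2 \<cdot> z) = b2 \<cdot> (b1 \<cdot> y)"
    by (simp add: square_Comp[OF sq(3), symmetric] fz)
  also have "\<dots> = Zero C (Src C (a2 \<cdot> z)) (Tgt C f3)"
    by (simp add: Comp_eq[OF col(3)])
  finally have 2: "a2 \<cdot> z = Zero C (Src C z) (Tgt C a2)"
    using mono_Zero[OF row(3), of "a2 \<cdot> z"] by simp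
  obtain e' w where e' [simp]: "e' \<in> Arr C" "epi_arr C e'" "Tgt C e' = Src C e"
    "w \<in> Arr C" "Src C w = Src C e'" "Tgt C w = Src C a1" and ze: "z \<cdot> e' = a1 \<cdot> w"
    by (rule cokernel_cover[OF col(1) _ _ 2]) simp_all
  have "b1 \<cdot> (y \<cdot> e') = f2 \<cdot> (z \<cdot> e')"
    by (simp add: Comp_eq_Comp[OF fz])
  also have "\<dots> = b1 \<cdot> (f1 \<cdot> w)"
    by (simp add: ze square_Comp[OF sq(1)])
  finally have yw: "y \<cdot> e' = f1 \<cdot> w"
    by (rule mono_cancel[OF col(2), rotated 4]) simp_all
  have "x \<cdot> (e \<cdot> e') = g1 \<cdot> (y \<cdot> e')"
    by (simp add: Comp_eq_Comp[OF xe])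
  also have "\<dots> = Zero C (Src C (e \<cdot> e')) (Tgt C x)"
    by (simp add: yw Comp_eq[OF is_cokernelD(4)[OF row(1)]])
  finally show "x = Zero C (Src C x) (Src C c1)"
    using epi_Zero[of "e \<cdot> e'" x] by (simp add: epi_Comp)
qed

text \<open>
  The nine lemma for kernels.  To see that \<open>g1\<close> is epi, a lift \<open>y\<close> along \<open>g2\<close> must be corrected by an
  element of the source of \<open>f2\<close> to land in the kernel of \<open>b2\<close>; the correction exists since \<open>a2\<close> is epi.
\<close>

lemma ses_of_kernels:
  assumes sq: "square f1 f2 a1 b1" "square g1 g2 b1 c1" "square f2 f3 a2 b2" "square g2 g3 b2 c2"
    and col: "is_kernel C a1 a2" "is_kernel C b1 b2" "is_kernel C c1 c2" "epi_arr C a2"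
    and row: "ses f2 g2" "ses f3 g3"
  shows "ses f1 g1"
proof -
  note [simp] = squareD(1-8)[OF sq(1)] squareD(1-8)[OF sq(2)] squareD(1-8)[OF sq(3)]
    squareD(1-8)[OF sq(4)] sesD(1-4)[OF row(1)] sesD(1-4)[OF row(2)]
    is_kernelD(4)[OF col(1)] is_kernelD(4)[OF col(2)] is_kernelD(4)[OF col(3)]
  have [simp]: "Tgt C b1 = Tgt C f2" "Tgt C b2 = Tgt C f3" "Src C g1 = Tgt C f1"
    using squareD(6)[OF sq(2)] squareD(6)[OF sq(4)] squareD(5)[OF sq(2)] by simp_all
  have mono_f1: "mono_arr C f1"
  proof (rule mono_left_factor)
    show "mono_arr C (b1 \<cdot> f1)"
      using mono_Comp[OF kernel_mono[OF col(1)] sesD(5)[OF row(1)]] by (simp add: squareD(9)[OF sq(1)])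
  qed simp_all
  have "c1 \<cdot> (g1 \<cdot> f1) = g2 \<cdot> (f2 \<cdot> a1)"
    by (simp add: square_Comp[OF sq(2)] squareD(9)[OF sq(1)])
  also have "\<dots> = Zero C (Src C f1) (Tgt C c1)"
    by (simp add: Comp_eq[OF sesD(4)[OF row(1)]])
  finally have gf: "g1 \<cdot> f1 = Zero C (Src C f1) (Tgt C g1)"
    using mono_Zero[OF kernel_mono[OF col(3)], of "g1 \<cdot> f1"] by simp
  have "is_kernel C f1 g1"
  proof (rule is_kernelI[OF mono_f1])
    fix h assume h [simp]: "h \<in> Arr C" "Tgt C h = Tgt C f1" and 0: "g1 \<cdot> h = Zero C (Src C h) (Tgt C g1)"
    have 1: "g2 \<cdot> (b1 \<cdot> h) = Zero C (Src C (b1 \<cdot> h)) (Tgt C g2)"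
      by (simp add: square_Comp[OF sq(2), symmetric] 0)
    obtain y where y [simp]: "y \<in> Arr C" "Src C y = Src C h" "Tgt C y = Src C f2" and fy: "f2 \<cdot> y = b1 \<cdot> h"
      by (rule kernel_lift[OF sesD(7)[OF row(1)] _ _ 1]) simp_all
    have "f3 \<cdot> (a2 \<cdot> y) = b2 \<cdot> (b1 \<cdot> h)"
      by (simp add: square_Comp[OF sq(3), symmetric] fy)
    also have "\<dots> = Zero C (Src C (a2 \<cdot> y)) (Tgt C f3)"
      by (simp add: Comp_eq[OF is_kernelD(4)[OF col(2)]])
    finally have "a2 \<cdot> y = Zero C (Src C y) (Tgt C a2)"
      using mono_Zero[OF sesD(5)[OF row(2)], of "a2 \<cdot> y"] by simp
    then obtain z where z [simp]: "z \<in> Arr C" "Src C z = Src C y" "Tgt C z = Src C a1" and az: "a1 \<cdot> z = y"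
      by (rule kernel_lift[OF col(1), rotated 2]) simp_all
    have "f1 \<cdot> z = h"
      by (rule mono_cancel[OF kernel_mono[OF col(2)]])
        (simp_all add: square_Comp[OF sq(1)] az fy)
    then show "\<exists>v. v \<in> Arr C \<and> Tgt C v = Src C f1 \<and> f1 \<cdot> v = h"
      using z by (intro exI[of _ z]) simp
  qed (simp_all add: gf)
  moreover have "epi_arr C g1"
  proof -
    obtain e y where e [simp]: "e \<in> Arr C" "epi_arr C e" "Tgt C e = Src C c1"
      "y \<in> Arr C" "Src C y = Src C e" "Tgt C y = Src C g2" and ce: "c1 \<cdot> e = g2 \<cdot> y"
      by (rule epi_lift[OF sesD(6)[OF row(1)], of c1]) simp_all
    have "g3 \<cdot> (b2 \<cdot> y) = c2 \<cdot> (c1 \<cdot> e)"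
      by (simp add: ce square_Comp[OF sq(4)])
    also have "\<dots> = Zero C (Src C (b2 \<cdot> y)) (Tgt C g3)"
      by (simp add: Comp_eq[OF is_kernelD(4)[OF col(3)]])
    finally have 1: "g3 \<cdot> (b2 \<cdot> y) = Zero C (Src C (b2 \<cdot> y)) (Tgt C g3)" .
    obtain z where z [simp]: "z \<in> Arr C" "Src C z = Src C e" "Tgt C z = Src C f3" and fz: "f3 \<cdot> z = b2 \<cdot> y"
      by (rule kernel_lift[OF sesD(7)[OF row(2)] _ _ 1]) simp_all
    obtain e' w where e' [simp]: "e' \<in> Arr C" "epi_arr C e'" "Tgt C e' = Src C e"
      "w \<in> Arr C" "Src C w = Src C e'" "Tgt C w = Src C a2" and ze: "z \<cdot> e' = a2 \<cdot> w"
      by (rule epi_lift[OF col(4), of z]) simp_all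
    let ?d = "(y \<cdot> e') \<boxminus> (f2 \<cdot> w)"
    have "b2 \<cdot> (y \<cdot> e') = f3 \<cdot> (z \<cdot> e')"
      by (simp add: Comp_eq_Comp[OF fz])
    also have "\<dots> = b2 \<cdot> (f2 \<cdot> w)"
      by (simp add: ze square_Comp[OF sq(3)])
    finally have 2: "b2 \<cdot> ?d = Zero C (Src C ?d) (Tgt C b2)"
      by (simp add: Comp_Minus Minus_eq_Zero_iff)
    obtain v where v [simp]: "v \<in> Arr C" "Src C v = Src C e'" "Tgt C v = Src C b1" and bv: "b1 \<cdot> v = ?d"
      by (rule kernel_lift[OF col(2) _ _ 2]) simp_all
    have "c1 \<cdot> (g1 \<cdot> v) = g2 \<cdot> ?d"
      by (simp add: square_Comp[OF sq(2)] bv)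
    also have "\<dots> = g2 \<cdot> (y \<cdot> e')"
      by (simp add: Comp_Minus Comp_eq[OF sesD(4)[OF row(1)]])
    also have "\<dots> = c1 \<cdot> (e \<cdot> e')"
      by (simp add: Comp_eq_Comp[OF ce])
    finally have "g1 \<cdot> v = e \<cdot> e'"
      by (rule mono_cancel[OF kernel_mono[OF col(3)], rotated 4]) simp_all
    moreover have "epi_arr C (e \<cdot> e')"
      by (rule epi_Comp) simp_all
    ultimately show ?thesis
      by (intro epi_right_factor[of g1 v]) simp_all
  qed
  ultimately show ?thesis
    by (rule ses_if_epi)
qed

lemma ses_of_cokernels:
  assumes "square f1 f2 a1 b1" "square g1 g2 b1 c1" "square f2 f3 a2 b2" "square g2 g3 b2 c2"
    and "is_cokernel C a2 a1" "is_cokernel C b2 b1" "is_cokernel C c2 c1" "mono_arr C c1"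
    and "ses f1 g1" "ses f2 g2"
  shows "ses f3 g3"
  using abelian_category.ses_of_kernels[OF abelian_opposite[OF abelian_category_axioms],
      of g3 g2 c2 b2 f3 f2 a2 g1 c1 b1 f1 a1] assms
  by (simp add: square_opposite ses_opposite)

end

section \<open>Additive functors and adjunctions\<close>

context preadditive_category
begin

lemma functor_arr [simp]:
  assumes "additive_functor C F" "f \<in> Arr C"
  shows "amap F f \<in> Arr C" "Src C (amap F f) = omap F (Src C f)" "Tgt C (amap F f) = omap F (Tgt C f)"
proof -
  have "amap F f \<in> Hom C (omap F (Src C f)) (omap F (Tgt C f))"
    using assms by (simp add: additive_functor_def Hom_def)
  then show "amap F f \<in> Arr C" "Src C (amap F f) = omap F (Src C f)" "Tgt C (amap F f) = omap F (Tgt C f)"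
    by (auto simp: Hom_def)
qed

lemma functor_Obj [simp]: "additive_functor C F \<Longrightarrow> A \<in> Obj C \<Longrightarrow> omap F A \<in> Obj C"
  and functor_Ident [simp]:
    "additive_functor C F \<Longrightarrow> A \<in> Obj C \<Longrightarrow> amap F (Ident C A) = Ident C (omap F A)"
  by (auto simp: additive_functor_def)

lemma functor_Comp [simp]:
  assumes "additive_functor C F" "f \<in> Arr C" "g \<in> Arr C" "Src C g = Tgt C f"
  shows "amap F (g \<cdot> f) = amap F g \<cdot> amap F f"
proof -
  have "f \<in> Hom C (Src C f) (Tgt C f)" "g \<in> Hom C (Tgt C f) (Tgt C g)"
    using assms by (auto simp: Hom_def)
  then show ?thesis
    using assms(1) unfolding additive_functor_def by blast
qed

lemma functor_Zero [simp]:
  assumes F: "additive_functor C F" and AB: "A \<in> Obj C" "B \<in> Obj C"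
  shows "amap F (Zero C A B) = Zero C (omap F A) (omap F B)"
proof -
  let ?z = "Zero C A B"
  note [simp] = F AB
  have "?z \<in> Hom C A B"
    by (simp add: Hom_def)
  then have "amap F (?z \<boxplus> ?z) = amap F ?z \<boxplus> amap F ?z"
    using F unfolding additive_functor_def by blast
  also have "?z \<boxplus> ?z = ?z"
    by simp
  finally have "amap F ?z \<boxplus> amap F ?z = amap F ?z \<boxplus> Zero C (omap F A) (omap F B)"
    by simp
  then show ?thesis
    by (subst (asm) Plus_cancel) simp_all
qed

lemma functor_eq:
  assumes "g \<cdot> f = g' \<cdot> f'" and "additive_functor C F"
    and "f \<in> Arr C" "g \<in> Arr C" "Src C g = Tgt C f" "f' \<in> Arr C" "g' \<in> Arr C" "Src C g' = Tgt C f'"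
  shows "amap F g \<cdot> amap F f = amap F g' \<cdot> amap F f'"
  using assms by (metis functor_Comp)

end

lemma additive_functor_opposite [simp]: "additive_functor (opposite C) F = additive_functor C F"
  by (auto simp: additive_functor_def)

lemma additive_functor_comp:
  assumes "additive_functor C F" "additive_functor C G"
  shows "additive_functor C (G \<circ>\<^sub>F F)"
proof -
  have F: "omap F A \<in> Obj C" if "A \<in> Obj C" for A
    using assms(1) that unfolding additive_functor_def by blast
  have F': "amap F f \<in> Hom C (omap F A) (omap F B)" if "f \<in> Hom C A B" for f A B
    using assms(1) that unfolding additive_functor_def by blast
  show ?thesis
    using assms F F' unfolding additive_functor_def comp_functor_def
    by (intro conjI ballI allI) (simp; metis)+
qed

lemma natural_transformation_opposite [simp]:
  "natural_transformation (opposite C) F G \<tau> = natural_transformation C G F \<tau>"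
  by (auto simp: natural_transformation_def)

lemma adjunction_opposite:
  "adjunction C F G \<eta> \<epsilon> \<Longrightarrow> adjunction (opposite C) G F \<epsilon> \<eta>"
  by (auto simp: adjunction_def)

context preadditive_category
begin

lemma adjunction_functors:
  assumes "adjunction C F G \<eta> \<epsilon>"
  shows "additive_functor C F" "additive_functor C G"
  using assms by (auto simp: adjunction_def)

lemma adjunction_unit:
  assumes "adjunction C F G \<eta> \<epsilon>" "A \<in> Obj C"
  shows "\<eta> A \<in> Arr C" "Src C (\<eta> A) = A" "Tgt C (\<eta> A) = omap G (omap F A)"
proof -
  have "\<eta> A \<in> Hom C A (omap G (omap F A))"
    using assms by (auto simp: adjunction_def natural_transformation_def id_functor_def comp_functor_def)
  then show "\<eta> A \<in> Arr C" "Src C (\<eta> A) = A" "Tgt C (\<eta> A) = omap G (omap F A)"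
    by (auto simp: Hom_def)
qed

lemma unit_natural:
  assumes "adjunction C F G \<eta> \<epsilon>" "f \<in> Arr C"
  shows "\<eta> (Tgt C f) \<cdot> f = amap G (amap F f) \<cdot> \<eta> (Src C f)"
proof -
  have "f \<in> Hom C (Src C f) (Tgt C f)"
    using assms by (simp add: Hom_def)
  then show ?thesis
    using assms(1)
    by (auto simp: adjunction_def natural_transformation_def id_functor_def comp_functor_def)
qed

lemmas adjunction_counit =
  preadditive_category.adjunction_unit[OF preadditive_opposite[OF preadditive_category_axioms]
    adjunction_opposite, simplified]
lemmas counit_natural =
  preadditive_category.unit_natural[OF preadditive_opposite[OF preadditive_category_axioms]
    adjunction_opposite, simplified]

lemma adjunction_triangles:
  assumes "adjunction C F G \<eta> \<epsilon>" "A \<in> Obj C"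
  shows "\<epsilon> (omap F A) \<cdot> amap F (\<eta> A) = Ident C (omap F A)"
    and "amap G (\<epsilon> A) \<cdot> \<eta> (omap G A) = Ident C (omap G A)"
  using assms by (auto simp: adjunction_def)

lemma transpose_transpose:
  assumes adj: "adjunction C F G \<eta> \<epsilon>" and h: "h \<in> Arr C" "Src C h = omap F A" and A: "A \<in> Obj C"
  shows "\<epsilon> (Tgt C h) \<cdot> (amap F (amap G h) \<cdot> amap F (\<eta> A)) = h"
proof -
  note [simp] = adjunction_functors[OF adj] adjunction_unit[OF adj] adjunction_counit[OF adj] h A
  have "\<epsilon> (Tgt C h) \<cdot> (amap F (amap G h) \<cdot> amap F (\<eta> A)) = h \<cdot> (\<epsilon> (omap F A) \<cdot> amap F (\<eta> A))"
    using counit_natural[OF adj h(1)] by (subst Comp_eq_Comp) simp_all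
  then show ?thesis
    by (simp add: adjunction_triangles[OF adj])
qed

text \<open>
  Arrows \<open>F X \<rightarrow> Y\<close> correspond to their transposes \<open>X \<rightarrow> G Y\<close>, and an arrow kills \<open>F f\<close> iff its transpose
  \<open>?t\<close> kills \<open>f\<close>; so the universal property is that of \<open>q\<close>.
\<close>

lemma left_adjoint_cokernel:
  assumes adj: "adjunction C F G \<eta> \<epsilon>" and q: "is_cokernel C q f"
  shows "is_cokernel C (amap F q) (amap F f)"
proof (rule is_cokernelI)
  note [simp] = adjunction_functors[OF adj] adjunction_unit[OF adj] adjunction_counit[OF adj]
    is_cokernelD[OF q]
  show "epi_arr C (amap F q)"
    unfolding epi_arr_iff
  proof (intro conjI ballI impI)
    fix h assume h [simp]: "h \<in> Arr C" "Src C h = Tgt C (amap F q)"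
      and 0: "h \<cdot> amap F q = Zero C (Src C (amap F q)) (Tgt C h)"
    let ?t = "amap G h \<cdot> \<eta> (Tgt C q)"
    have "?t \<cdot> q = amap G h \<cdot> (amap G (amap F q) \<cdot> \<eta> (Src C q))"
      by (simp add: unit_natural[OF adj, of q])
    also have "\<dots> = amap G (h \<cdot> amap F q) \<cdot> \<eta> (Src C q)"
      by simp
    also have "\<dots> = Zero C (Src C q) (Tgt C ?t)"
      unfolding 0 by simp
    finally have "?t = Zero C (Tgt C q) (Tgt C ?t)"
      using epi_Zero[OF cokernel_epi[OF q], of ?t] by simp
    then have "amap F ?t = amap F (Zero C (Tgt C q) (Tgt C ?t))"
      by (rule arg_cong)
    then have "amap F (amap G h) \<cdot> amap F (\<eta> (Tgt C q)) = Zero C (omap F (Tgt C q)) (omap F (omap G (Tgt C h)))"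
      by simp
    then show "h = Zero C (Tgt C (amap F q)) (Tgt C h)"
      using transpose_transpose[OF adj, of h "Tgt C q"] by simp
  qed simp
  show "amap F q \<cdot> amap F f = Zero C (Src C (amap F f)) (Tgt C (amap F q))"
    by (simp flip: functor_Comp)
  fix h assume h [simp]: "h \<in> Arr C" "Src C h = Src C (amap F q)"
    and 0: "h \<cdot> amap F f = Zero C (Src C (amap F f)) (Tgt C h)"
  let ?t = "amap G h \<cdot> \<eta> (Src C q)"
  have "?t \<cdot> f = amap G h \<cdot> (amap G (amap F f) \<cdot> \<eta> (Src C f))"
    using unit_natural[OF adj, of f] by simp
  also have "\<dots> = amap G (h \<cdot> amap F f) \<cdot> \<eta> (Src C f)"
    by simp
  also have "\<dots> = Zero C (Src C f) (Tgt C ?t)"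
    unfolding 0 by simp
  finally have 1: "?t \<cdot> f = Zero C (Src C f) (Tgt C ?t)" .
  obtain v where v [simp]: "v \<in> Arr C" "Src C v = Tgt C q" "Tgt C v = omap G (Tgt C h)" and vq: "v \<cdot> q = ?t"
    by (rule cokernel_desc[OF q _ _ 1]) simp_all
  have "(\<epsilon> (Tgt C h) \<cdot> amap F v) \<cdot> amap F q = \<epsilon> (Tgt C h) \<cdot> amap F (v \<cdot> q)"
    by simp
  also have "\<dots> = h"
    unfolding vq using transpose_transpose[OF adj, of h "Src C q"] by simp
  finally show "\<exists>w. w \<in> Arr C \<and> Src C w = Tgt C (amap F q) \<and> w \<cdot> amap F q = h"
    by (intro exI[of _ "\<epsilon> (Tgt C h) \<cdot> amap F v"]) simp
qed (use is_cokernelD[OF q] adjunction_functors[OF adj] in simp_all)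

lemmas right_adjoint_kernel =
  preadditive_category.left_adjoint_cokernel[OF preadditive_opposite[OF preadditive_category_axioms]
    adjunction_opposite, simplified]

text \<open>
  The unit and the counit are corrected by the isomorphism \<open>\<tau>\<close> and its inverse \<open>\<sigma>\<close>, whose naturality
  is inherited from \<open>\<tau>\<close>.
\<close>

lemma adjunction_iso_left:
  assumes adj: "adjunction C F G \<eta> \<epsilon>" and F': "additive_functor C F'"
    and \<tau>: "\<And>A. A \<in> Obj C \<Longrightarrow> \<tau> A \<in> Arr C \<and> Src C (\<tau> A) = omap F A \<and> Tgt C (\<tau> A) = omap F' A"
    and \<sigma>: "\<And>A. A \<in> Obj C \<Longrightarrow> \<sigma> A \<in> Arr C \<and> Src C (\<sigma> A) = omap F' A \<and> Tgt C (\<sigma> A) = omap F A"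
    and inv: "\<And>A. A \<in> Obj C \<Longrightarrow> \<sigma> A \<cdot> \<tau> A = Ident C (omap F A)"
      "\<And>A. A \<in> Obj C \<Longrightarrow> \<tau> A \<cdot> \<sigma> A = Ident C (omap F' A)"
    and nat: "\<And>f. f \<in> Arr C \<Longrightarrow> \<tau> (Tgt C f) \<cdot> amap F f = amap F' f \<cdot> \<tau> (Src C f)"
  shows "adjunction C F' G (\<lambda>A. amap G (\<tau> A) \<cdot> \<eta> A) (\<lambda>A. \<epsilon> A \<cdot> \<sigma> (omap G A))"
proof -
  note [simp] = adjunction_functors[OF adj] adjunction_unit[OF adj] adjunction_counit[OF adj] F'
  have [simp]: "\<tau> A \<in> Arr C" "Src C (\<tau> A) = omap F A" "Tgt C (\<tau> A) = omap F' A"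
    "\<sigma> A \<in> Arr C" "Src C (\<sigma> A) = omap F' A" "Tgt C (\<sigma> A) = omap F A" if "A \<in> Obj C" for A
    using \<tau>[OF that] \<sigma>[OF that] by auto
  have nat': "\<sigma> (Tgt C f) \<cdot> amap F' f = amap F f \<cdot> \<sigma> (Src C f)" if [simp]: "f \<in> Arr C" for f
  proof -
    have "\<sigma> (Tgt C f) \<cdot> amap F' f = \<sigma> (Tgt C f) \<cdot> (amap F' f \<cdot> (\<tau> (Src C f) \<cdot> \<sigma> (Src C f)))"
      by (simp add: inv)
    also have "\<dots> = \<sigma> (Tgt C f) \<cdot> (\<tau> (Tgt C f) \<cdot> (amap F f \<cdot> \<sigma> (Src C f)))"
      by (simp add: Comp_eq_Comp[OF nat[OF that]])
    also have "\<dots> = amap F f \<cdot> \<sigma> (Src C f)"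
      by (simp add: Comp_eq[OF inv(1)])
    finally show ?thesis .
  qed
  have 1: "natural_transformation C id_functor (G \<circ>\<^sub>F F') (\<lambda>A. amap G (\<tau> A) \<cdot> \<eta> A)"
    unfolding natural_transformation_def
  proof (intro conjI ballI allI)
    fix A assume "A \<in> Obj C"
    then show "amap G (\<tau> A) \<cdot> \<eta> A \<in> Hom C (omap id_functor A) (omap (G \<circ>\<^sub>F F') A)"
      by (simp add: Hom_def id_functor_def comp_functor_def)
  next
    fix A B f assume "f \<in> Hom C A B"
    then have f [simp]: "f \<in> Arr C" and [simp]: "A = Src C f" "B = Tgt C f"
      by (auto simp: Hom_def)
    have e: "amap G (\<tau> (Tgt C f)) \<cdot> amap G (amap F f) = amap G (amap F' f) \<cdot> amap G (\<tau> (Src C f))"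
      using functor_eq[OF nat[OF f], of G] by simp
    have "amap G (\<tau> B) \<cdot> (\<eta> B \<cdot> f) = (amap G (\<tau> B) \<cdot> amap G (amap F f)) \<cdot> \<eta> A"
      by (simp add: unit_natural[OF adj])
    also have "\<dots> = amap G (amap F' f) \<cdot> (amap G (\<tau> A) \<cdot> \<eta> A)"
      by (simp add: Comp_eq_Comp[OF e])
    finally show "(amap G (\<tau> B) \<cdot> \<eta> B) \<cdot> amap id_functor f = amap (G \<circ>\<^sub>F F') f \<cdot> (amap G (\<tau> A) \<cdot> \<eta> A)"
      by (simp add: id_functor_def comp_functor_def)
  qed
  have 2: "natural_transformation C (F' \<circ>\<^sub>F G) id_functor (\<lambda>A. \<epsilon> A \<cdot> \<sigma> (omap G A))"
    unfolding natural_transformation_def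
  proof (intro conjI ballI allI)
    fix A assume "A \<in> Obj C"
    then show "\<epsilon> A \<cdot> \<sigma> (omap G A) \<in> Hom C (omap (F' \<circ>\<^sub>F G) A) (omap id_functor A)"
      by (simp add: Hom_def id_functor_def comp_functor_def)
  next
    fix A B f assume "f \<in> Hom C A B"
    then have f [simp]: "f \<in> Arr C" and [simp]: "A = Src C f" "B = Tgt C f"
      by (auto simp: Hom_def)
    have "\<epsilon> B \<cdot> (\<sigma> (omap G B) \<cdot> amap F' (amap G f)) = \<epsilon> B \<cdot> (amap F (amap G f) \<cdot> \<sigma> (omap G A))"
      using nat'[of "amap G f"] by simp
    also have "\<dots> = f \<cdot> (\<epsilon> A \<cdot> \<sigma> (omap G A))"
      using counit_natural[OF adj f] by (subst Comp_eq_Comp) simp_all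
    finally show "(\<epsilon> B \<cdot> \<sigma> (omap G B)) \<cdot> amap (F' \<circ>\<^sub>F G) f = amap id_functor f \<cdot> (\<epsilon> A \<cdot> \<sigma> (omap G A))"
      by (simp add: id_functor_def comp_functor_def)
  qed
  have 3: "(\<epsilon> (omap F' A) \<cdot> \<sigma> (omap G (omap F' A))) \<cdot> amap F' (amap G (\<tau> A) \<cdot> \<eta> A) = Ident C (omap F' A)"
    if [simp]: "A \<in> Obj C" for A
  proof -
    have e1: "\<sigma> (omap G (omap F' A)) \<cdot> amap F' (amap G (\<tau> A)) = amap F (amap G (\<tau> A)) \<cdot> \<sigma> (omap G (omap F A))"
      and e2: "\<sigma> (omap G (omap F A)) \<cdot> amap F' (\<eta> A) = amap F (\<eta> A) \<cdot> \<sigma> A"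
      and e3: "\<epsilon> (omap F' A) \<cdot> amap F (amap G (\<tau> A)) = \<tau> A \<cdot> \<epsilon> (omap F A)"
      using nat'[of "amap G (\<tau> A)"] nat'[of "\<eta> A"] counit_natural[OF adj, of "\<tau> A"] by simp_all
    have "\<sigma> (omap G (omap F' A)) \<cdot> (amap F' (amap G (\<tau> A)) \<cdot> amap F' (\<eta> A))
        = amap F (amap G (\<tau> A)) \<cdot> (amap F (\<eta> A) \<cdot> \<sigma> A)"
      by (simp add: Comp_eq_Comp[OF e1] e2)
    moreover have "\<epsilon> (omap F' A) \<cdot> (amap F (amap G (\<tau> A)) \<cdot> (amap F (\<eta> A) \<cdot> \<sigma> A))
        = \<tau> A \<cdot> (\<epsilon> (omap F A) \<cdot> (amap F (\<eta> A) \<cdot> \<sigma> A))"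
      by (simp add: Comp_eq_Comp[OF e3])
    moreover have "\<epsilon> (omap F A) \<cdot> (amap F (\<eta> A) \<cdot> \<sigma> A) = \<sigma> A"
      by (simp add: Comp_eq[OF adjunction_triangles(1)[OF adj]])
    ultimately show ?thesis
      by (simp add: inv)
  qed
  have 4: "amap G (\<epsilon> A \<cdot> \<sigma> (omap G A)) \<cdot> (amap G (\<tau> (omap G A)) \<cdot> \<eta> (omap G A)) = Ident C (omap G A)"
    if [simp]: "A \<in> Obj C" for A
  proof -
    have "amap G (\<sigma> (omap G A)) \<cdot> (amap G (\<tau> (omap G A)) \<cdot> \<eta> (omap G A))
        = amap G (\<sigma> (omap G A) \<cdot> \<tau> (omap G A)) \<cdot> \<eta> (omap G A)"
      by simp
    also have "\<dots> = \<eta> (omap G A)"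
      unfolding inv(1)[OF functor_Obj[OF adjunction_functors(2)[OF adj] that]] by simp
    finally show ?thesis
      by (simp add: adjunction_triangles[OF adj])
  qed
  show ?thesis
    unfolding adjunction_def using 1 2 3 4 by (intro conjI ballI) simp_all
qed

end

section \<open>Retracts and split sequences\<close>

context preadditive_category
begin

text \<open>
  In an abelian category retracts and direct summands agree; the former need no choice of a complement
  and are stable under arbitrary functors.
\<close>

definition retract :: "'o \<Rightarrow> 'o \<Rightarrow> bool" where
  "retract A B \<longleftrightarrow> (\<exists>i r. i \<in> Arr C \<and> r \<in> Arr C \<and> Src C i = A \<and> Tgt C i = B \<and>
    Src C r = B \<and> Tgt C r = A \<and> r \<cdot> i = Ident C A)"

lemma retractI:
  assumes "i \<in> Arr C" "r \<in> Arr C" "Src C r = Tgt C i" "r \<cdot> i = Ident C (Src C i)"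
  shows "retract (Src C i) (Tgt C i)"
proof -
  have "Tgt C r = Src C i"
    using assms by (metis Comp_arr(3) Ident_arr(3) Src_Obj)
  then show ?thesis
    unfolding retract_def using assms by blast
qed

lemma retractE:
  assumes "retract A B"
  obtains i r where "i \<in> Arr C" "r \<in> Arr C" "Src C i = A" "Tgt C i = B"
    "Src C r = B" "Tgt C r = A" "r \<cdot> i = Ident C A"
  using assms unfolding retract_def by blast

lemma retract_Obj:
  assumes "retract A B"
  shows "A \<in> Obj C" "B \<in> Obj C"
  using assms Src_Obj Tgt_Obj unfolding retract_def by blast+

lemma retract_refl: "A \<in> Obj C \<Longrightarrow> retract A A"
  using retractI[of "Ident C A" "Ident C A"] by simp

lemma retract_trans:
  assumes "retract A B" "retract B D"
  shows "retract A D"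
proof -
  obtain i r where [simp]: "i \<in> Arr C" "r \<in> Arr C" "Src C i = A" "Tgt C i = B"
    "Src C r = B" "Tgt C r = A" and ri: "r \<cdot> i = Ident C A"
    by (rule retractE[OF assms(1)])
  obtain j s where [simp]: "j \<in> Arr C" "s \<in> Arr C" "Src C j = B" "Tgt C j = D"
    "Src C s = D" "Tgt C s = B" and sj: "s \<cdot> j = Ident C B"
    by (rule retractE[OF assms(2)])
  have "(r \<cdot> s) \<cdot> (j \<cdot> i) = Ident C A"
    by (simp add: Comp_eq[OF sj] ri)
  then show ?thesis
    using retractI[of "j \<cdot> i" "r \<cdot> s"] by simp
qed

lemma direct_summand_retract:
  assumes "direct_summand C A B"
  shows "retract A B"
  using assms by (auto simp: direct_summand_def is_biproduct_def retract_def Hom_def)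

end

context abelian_category
begin

text \<open>If \<open>s\<close> splits \<open>p\<close>, then \<open>1 - s \<cdot> p\<close> factors through the kernel of \<open>p\<close>.\<close>

lemma kernel_retraction:
  assumes k: "is_kernel C k p" and s: "s \<in> Arr C" "Src C s = Tgt C p" "Tgt C s = Src C p"
    and ps: "p \<cdot> s = Ident C (Tgt C p)"
  obtains r where "r \<in> Arr C" "Src C r = Tgt C k" "Tgt C r = Src C k" "r \<cdot> k = Ident C (Src C k)"
proof -
  note [simp] = is_kernelD[OF k] s
  let ?d = "Ident C (Tgt C k) \<boxminus> (s \<cdot> p)"
  have 0: "p \<cdot> ?d = Zero C (Src C ?d) (Tgt C p)"
    by (simp add: Comp_Minus Minus_eq_Zero_iff Comp_eq[OF ps])
  obtain r where r [simp]: "r \<in> Arr C" "Src C r = Tgt C k" "Tgt C r = Src C k" and kr: "k \<cdot> r = ?d"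
    by (rule kernel_lift[OF k _ _ 0]) simp_all
  have "k \<cdot> (r \<cdot> k) = ?d \<cdot> k"
    using kr by (simp flip: Comp_Comp)
  also have "\<dots> = k \<cdot> Ident C (Src C k)"
    by (simp add: Minus_Comp)
  finally have "r \<cdot> k = Ident C (Src C k)"
    by (rule mono_cancel[OF kernel_mono[OF k], rotated 4]) simp_all
  then show thesis
    using that[of r] by simp
qed

lemmas cokernel_section =
  abelian_category.kernel_retraction[OF abelian_opposite[OF abelian_category_axioms], simplified]

lemma square_mono_left:
  assumes "square f g a b" "mono_arr C f" "mono_arr C b"
  shows "mono_arr C a"
proof (rule mono_left_factor)
  show "mono_arr C (g \<cdot> a)"
    using mono_Comp[OF assms(2,3)] squareD[OF assms(1)] by simp
qed (use squareD[OF assms(1)] in simp_all)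

lemma square_mono_top:
  assumes "square f g a b" "mono_arr C a" "mono_arr C g"
  shows "mono_arr C f"
proof (rule mono_left_factor)
  show "mono_arr C (b \<cdot> f)"
    using mono_Comp[OF assms(2,3)] squareD[OF assms(1)] by simp
qed (use squareD[OF assms(1)] in simp_all)

lemma functor_square:
  assumes F: "additive_functor C F" and "square f g a b"
  shows "square (amap F f) (amap F g) (amap F a) (amap F b)"
proof -
  note [simp] = F squareD(1-8)[OF assms(2)]
  show ?thesis
    using functor_eq[OF squareD(9)[OF assms(2)] F] by (simp add: square_def)
qed

lemma functor_split_mono:
  assumes [simp]: "additive_functor C F" and [simp]: "f \<in> Arr C" "r \<in> Arr C" "Src C r = Tgt C f"
    and rf: "r \<cdot> f = Ident C (Src C f)"
  shows "mono_arr C (amap F f)"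
proof (rule split_mono)
  have "amap F (r \<cdot> f) = Ident C (omap F (Src C f))"
    unfolding rf by simp
  then show "amap F r \<cdot> amap F f = Ident C (Src C (amap F f))"
    by simp
qed simp_all

lemma kernels_square:
  assumes sq: "square f g a b" and k: "is_kernel C k a" and l: "is_kernel C l b"
  obtains w where "square w f k l"
proof -
  note [simp] = squareD(1-8)[OF sq] is_kernelD(1,2)[OF k] is_kernelD(1,2)[OF l]
  have [simp]: "Tgt C k = Src C f" "Tgt C l = Tgt C f"
    using is_kernelD(3)[OF k] is_kernelD(3)[OF l] by simp_all
  have 0: "b \<cdot> (f \<cdot> k) = Zero C (Src C (f \<cdot> k)) (Tgt C b)"
    using is_kernelD(4)[OF k] by (simp add: square_Comp[OF sq])
  obtain w where "w \<in> Arr C" "Src C w = Src C k" "Tgt C w = Src C l" "l \<cdot> w = f \<cdot> k"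
    by (rule kernel_lift[OF l _ _ 0]) simp_all
  then show thesis
    using that[of w] by (simp add: square_def)
qed

lemma cokernels_square:
  assumes "square f g a b" "is_cokernel C k a" "is_cokernel C l b"
  obtains w where "square g w k l"
  using abelian_category.kernels_square[OF abelian_opposite[OF abelian_category_axioms],
      of g f b a l k] assms
  by (auto simp: square_opposite)

end

section \<open>Relative syzygies\<close>

text \<open>
  This is what remains of a Nakayama functor after replacing \<open>\<nu>\<close> by \<open>S = P \<circ> \<nu>\<close>.  The two adjunctions
  share their counit \<open>c\<close>, which is meaningful because \<open>S \<circ> P\<close> and \<open>P \<circ> I\<close> are the same functor.
\<close>

locale adjoint_triple = abelian_category C
  for C :: "('o, 'm) precategory" (structure) +
  fixes S P I :: "('o, 'm) endofunctor" and u h c :: "'o \<Rightarrow> 'm"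
  assumes SP: "adjunction C S P u c"
    and PI: "adjunction C P I h c"
    and S_P_eq: "S \<circ>\<^sub>F P = P \<circ>\<^sub>F I"
    and I_cokernel: "is_cokernel C q f \<Longrightarrow> is_cokernel C (amap I q) (amap I f)"
    and epi_c: "A \<in> Obj C \<Longrightarrow> epi_arr C (c A)"
begin

lemmas functors [simp] = adjunction_functors[OF SP] adjunction_functors(2)[OF PI]

lemma omap_S_P [simp]: "omap S (omap P A) = omap P (omap I A)"
  and amap_S_P: "amap S (amap P f) = amap P (amap I f)"
  using S_P_eq by (simp_all add: comp_functor_def fun_eq_iff)

lemmas u_arr [simp] = adjunction_unit[OF SP]
lemmas h_arr [simp] = adjunction_unit[OF PI]
lemmas c_arr [simp] = adjunction_counit[OF PI]

text \<open>As \<open>P\<close> is a left and a right adjoint it is exact; \<open>I\<close> is a right adjoint and preserves cokernels.\<close>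

lemma P_ses: "ses f g \<Longrightarrow> ses (amap P f) (amap P g)"
  and I_ses: "ses f g \<Longrightarrow> ses (amap I f) (amap I g)"
  using left_adjoint_cokernel[OF PI] right_adjoint_kernel[OF SP] right_adjoint_kernel[OF PI] I_cokernel
  by (auto simp: ses_def)

lemma S_cokernel: "is_cokernel C q f \<Longrightarrow> is_cokernel C (amap S q) (amap S f)"
  by (rule left_adjoint_cokernel[OF SP])

abbreviation T :: "'m \<Rightarrow> 'm" where
  "T f \<equiv> amap P (amap I f)"

lemma T_ses: "ses f g \<Longrightarrow> ses (T f) (T g)"
  by (intro P_ses I_ses)

text \<open>
  Here it matters that \<open>S \<circ> P = P \<circ> I\<close>: although \<open>S\<close> is only right exact, \<open>S \<circ> T = P \<circ> I \<circ> I\<close> is exact.  So the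
  objects \<open>T A\<close> can serve to compute the derived functors of \<open>S\<close>.
\<close>

lemma S_T_ses: "ses f g \<Longrightarrow> ses (amap S (T f)) (amap S (T g))"
  unfolding amap_S_P by (intro P_ses I_ses)

lemma S_mono_ses: "ses f g \<Longrightarrow> mono_arr C (amap S f) \<Longrightarrow> ses (amap S f) (amap S g)"
  by (rule ses_if_mono[OF S_cokernel[OF sesD(8)]])

lemma c_square: "f \<in> Arr C \<Longrightarrow> square (T f) f (c (Src C f)) (c (Tgt C f))"
  using counit_natural[OF PI, of f] by (simp add: square_def)

lemma u_square: "f \<in> Arr C \<Longrightarrow> square f (amap P (amap S f)) (u (Src C f)) (u (Tgt C f))"
  using unit_natural[OF SP, of f] by (simp add: square_def)

definition syz_incl :: "'o \<Rightarrow> 'm" where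
  "syz_incl A = (SOME k. is_kernel C k (c A))"

definition syz :: "'o \<Rightarrow> 'o" where
  "syz A = Src C (syz_incl A)"

definition cosyz_proj :: "'o \<Rightarrow> 'm" where
  "cosyz_proj A = (SOME q. is_cokernel C q (u A))"

definition cosyz :: "'o \<Rightarrow> 'o" where
  "cosyz A = Tgt C (cosyz_proj A)"

lemma syz_kernel: "A \<in> Obj C \<Longrightarrow> is_kernel C (syz_incl A) (c A)"
  unfolding syz_incl_def by (rule someI_ex) (simp add: kernel_exists)

lemma cosyz_cokernel: "A \<in> Obj C \<Longrightarrow> is_cokernel C (cosyz_proj A) (u A)"
  unfolding cosyz_proj_def by (rule someI_ex) (simp add: cokernel_exists)

lemma syz_arr [simp]:
  assumes "A \<in> Obj C"
  shows "syz_incl A \<in> Arr C" "Src C (syz_incl A) = syz A" "Tgt C (syz_incl A) = omap P (omap I A)"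
    "syz A \<in> Obj C"
  using is_kernelD(1,3)[OF syz_kernel[OF assms]] assms Src_Obj[of "syz_incl A"] by (simp_all add: syz_def)

lemma cosyz_arr [simp]:
  assumes "A \<in> Obj C"
  shows "cosyz_proj A \<in> Arr C" "Src C (cosyz_proj A) = omap P (omap S A)" "Tgt C (cosyz_proj A) = cosyz A"
    "cosyz A \<in> Obj C"
  using is_cokernelD(1,3)[OF cosyz_cokernel[OF assms]] assms Tgt_Obj[of "cosyz_proj A"]
  by (simp_all add: cosyz_def)

lemma syz_ses: "A \<in> Obj C \<Longrightarrow> ses (syz_incl A) (c A)"
  by (rule ses_if_epi[OF syz_kernel epi_c])

lemma cosyz_ses: "A \<in> Obj C \<Longrightarrow> mono_arr C (u A) \<Longrightarrow> ses (u A) (cosyz_proj A)"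
  by (rule ses_if_mono[OF cosyz_cokernel])

lemma syz_map:
  assumes "f \<in> Arr C"
  obtains w where "square w (T f) (syz_incl (Src C f)) (syz_incl (Tgt C f))"
  using kernels_square[OF c_square[OF assms] syz_kernel syz_kernel] assms by auto

lemma cosyz_map:
  assumes "f \<in> Arr C"
  obtains w where "square (amap P (amap S f)) w (cosyz_proj (Src C f)) (cosyz_proj (Tgt C f))"
  using cokernels_square[OF u_square[OF assms] cosyz_cokernel cosyz_cokernel] assms by auto

lemma syz_of_ses:
  assumes "ses f g"
  obtains f' g' where "ses f' g'" "Src C f' = syz (Src C f)" "Tgt C f' = syz (Tgt C f)"
    "Tgt C g' = syz (Tgt C g)"
    "square f' (T f) (syz_incl (Src C f)) (syz_incl (Tgt C f))"
    "square g' (T g) (syz_incl (Tgt C f)) (syz_incl (Tgt C g))"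
proof -
  note [simp] = sesD(1-3)[OF assms]
  obtain f' where f': "square f' (T f) (syz_incl (Src C f)) (syz_incl (Tgt C f))"
    by (rule syz_map[of f]) simp_all
  obtain g' where g': "square g' (T g) (syz_incl (Tgt C f)) (syz_incl (Tgt C g))"
    by (rule syz_map[of g]) simp_all
  have "ses f' g'"
    by (rule ses_of_kernels[OF f' g' c_square _ syz_kernel syz_kernel syz_kernel epi_c T_ses[OF assms] assms])
      (use c_square[of g] in simp_all)
  moreover have "Src C f' = syz (Src C f)" "Tgt C f' = syz (Tgt C f)" "Tgt C g' = syz (Tgt C g)"
    using squareD[OF f'] squareD[OF g'] by simp_all
  ultimately show thesis
    using that f' g' by blast
qed

text \<open>
  The functor \<open>P \<circ> S\<close> is only right exact, hence the hypothesis that \<open>S\<close> keeps \<open>f\<close> mono; after that this is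
  the nine lemma for cokernels, whose condition on the columns is that the unit is mono at the last object.
\<close>

lemma cosyz_of_ses:
  assumes "ses f g" "mono_arr C (amap S f)" "mono_arr C (u (Tgt C g))"
  obtains f' g' where "ses f' g'" "Src C f' = cosyz (Src C f)" "Tgt C f' = cosyz (Tgt C f)"
    "Tgt C g' = cosyz (Tgt C g)"
proof -
  note [simp] = sesD(1-3)[OF assms(1)]
  obtain f' where f': "square (amap P (amap S f)) f' (cosyz_proj (Src C f)) (cosyz_proj (Tgt C f))"
    by (rule cosyz_map[of f]) simp_all
  obtain g' where g': "square (amap P (amap S g)) g' (cosyz_proj (Tgt C f)) (cosyz_proj (Tgt C g))"
    by (rule cosyz_map[of g]) simp_all
  have "ses f' g'"
    by (rule ses_of_cokernels[OF u_square _ f' g' cosyz_cokernel cosyz_cokernel cosyz_cokernel assms(3,1)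
          P_ses[OF S_mono_ses[OF assms(1,2)]]])
      (use u_square[of g] in simp_all)
  moreover have "Src C f' = cosyz (Src C f)" "Tgt C f' = cosyz (Tgt C f)" "Tgt C g' = cosyz (Tgt C g)"
    using squareD[OF f'] squareD[OF g'] by simp_all
  ultimately show thesis
    using that by blast
qed

subsection \<open>Vanishing of the first derived functor\<close>

text \<open>
  Since \<open>S \<circ> T\<close> is exact, the kernel of \<open>S (syz A) \<rightarrow> S (T A)\<close> is the first left derived functor of \<open>S\<close>
  at \<open>A\<close>.  For a short exact sequence \<open>0 \<rightarrow> A \<rightarrow> B \<rightarrow> D \<rightarrow> 0\<close>, the lemmas below are the following parts of
  the long exact sequence \<open>L\<^sub>2 D \<rightarrow> L\<^sub>1 A \<rightarrow> L\<^sub>1 B \<rightarrow> L\<^sub>1 D \<rightarrow> S A \<rightarrow> S B\<close>: exactness at \<open>S A\<close>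
  (\<open>S_mono_if_flat\<close>), at \<open>L\<^sub>1 D\<close> (\<open>S_flat_quotient\<close>), at \<open>L\<^sub>1 B\<close> (\<open>S_flat_extension\<close>) and at \<open>L\<^sub>1 A\<close>
  (\<open>S_flat_sub\<close>, where \<open>L\<^sub>2 D\<close> is \<open>L\<^sub>1\<close> of the syzygy of \<open>D\<close>).
\<close>

definition S_flat :: "'o \<Rightarrow> bool" where
  "S_flat A \<longleftrightarrow> mono_arr C (amap S (syz_incl A))"

lemma S_syz_diagram:
  assumes "ses f g" "square f' (T f) (syz_incl (Src C f)) (syz_incl (Tgt C f))"
    "square g' (T g) (syz_incl (Tgt C f)) (syz_incl (Tgt C g))"
  shows "square (amap S f') (amap S (T f)) (amap S (syz_incl (Src C f))) (amap S (syz_incl (Tgt C f)))"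
    "square (amap S g') (amap S (T g)) (amap S (syz_incl (Tgt C f))) (amap S (syz_incl (Tgt C g)))"
    "square (amap S (T f)) (amap S f) (amap S (c (Src C f))) (amap S (c (Tgt C f)))"
  using assms sesD(1)[OF assms(1)] by (auto intro!: functor_square c_square)

lemma S_syz_cokernel:
  "A \<in> Obj C \<Longrightarrow> is_cokernel C (amap S (c A)) (amap S (syz_incl A))"
  by (rule S_cokernel[OF sesD(8)[OF syz_ses]])

lemma S_mono_if_flat:
  assumes "ses f g" "S_flat (Tgt C g)"
  shows "mono_arr C (amap S f)"
proof -
  obtain f' g' where 1: "ses f' g'"
    and 2: "square f' (T f) (syz_incl (Src C f)) (syz_incl (Tgt C f))"
    "square g' (T g) (syz_incl (Tgt C f)) (syz_incl (Tgt C g))"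
    by (rule syz_of_ses[OF assms(1)])
  show ?thesis
    by (rule mono_on_cokernels[OF S_syz_diagram[OF assms(1) 2] S_syz_cokernel S_syz_cokernel _
          S_cokernel[OF sesD(8)[OF 1]] sesD(5,4)[OF S_T_ses[OF assms(1)]]])
      (use assms sesD(1-3)[OF assms(1)] in \<open>simp_all add: S_flat_def\<close>)
qed

lemma S_flat_quotient:
  assumes "ses f g" "mono_arr C (amap S f)" "S_flat (Tgt C f)"
  shows "S_flat (Tgt C g)"
proof -
  obtain f' g' where 1: "ses f' g'"
    and 2: "square f' (T f) (syz_incl (Src C f)) (syz_incl (Tgt C f))"
    "square g' (T g) (syz_incl (Tgt C f)) (syz_incl (Tgt C g))"
    by (rule syz_of_ses[OF assms(1)])
  note [simp] = sesD(1-3)[OF assms(1)]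
  show ?thesis
    unfolding S_flat_def
    by (rule mono_on_last_column[OF S_syz_diagram[OF assms(1) 2] S_syz_cokernel _ 
          is_cokernelD(4)[OF S_syz_cokernel]
          S_cokernel[OF sesD(8)[OF 1]] sesD(7)[OF S_T_ses[OF assms(1)]] assms(2)])
      (use assms(3) in \<open>simp_all add: S_flat_def\<close>)
qed

lemma S_flat_extension:
  assumes "ses f g" "S_flat (Src C f)" "S_flat (Tgt C g)"
  shows "S_flat (Tgt C f)"
proof -
  obtain f' g' where 1: "ses f' g'"
    and 2: "square f' (T f) (syz_incl (Src C f)) (syz_incl (Tgt C f))"
    "square g' (T g) (syz_incl (Tgt C f)) (syz_incl (Tgt C g))"
    by (rule syz_of_ses[OF assms(1)])
  show ?thesis
    unfolding S_flat_def
    by (rule four_lemma_mono[OF S_syz_diagram(1,2)[OF assms(1) 2]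
          S_cokernel[OF sesD(8)[OF 1]] sesD(5)[OF S_T_ses[OF assms(1)]]])
      (use assms(2,3) in \<open>simp_all add: S_flat_def\<close>)
qed

lemma S_flat_sub:
  assumes "ses f g" "S_flat (Tgt C f)" "S_flat (syz (Tgt C g))"
  shows "S_flat (Src C f)"
proof -
  obtain f' g' where 1: "ses f' g'" "Tgt C g' = syz (Tgt C g)"
    and 2: "square f' (T f) (syz_incl (Src C f)) (syz_incl (Tgt C f))"
    "square g' (T g) (syz_incl (Tgt C f)) (syz_incl (Tgt C g))"
    by (rule syz_of_ses[OF assms(1)])
  have "mono_arr C (amap S f')"
    by (rule S_mono_if_flat[OF 1(1)]) (simp add: 1 assms)
  then show ?thesis
    using square_mono_left[OF S_syz_diagram(1)[OF assms(1) 2]] assms(2) by (simp add: S_flat_def)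
qed

lemma S_mono_syz:
  assumes "ses f g" "mono_arr C (amap S f)" "S_flat (Src C f)"
    and "square f' (T f) (syz_incl (Src C f)) (syz_incl (Tgt C f))"
  shows "mono_arr C (amap S f')"
  using square_mono_top[OF functor_square[OF functors(1) assms(4)]] assms(3)
    sesD(5)[OF S_T_ses[OF assms(1)]] by (simp add: S_flat_def)

lemma syz_retract:
  assumes "retract A B"
  shows "retract (syz A) (syz B)" "S_flat B \<Longrightarrow> S_flat A"
proof -
  note [simp] = retract_Obj[OF assms]
  obtain i r where [simp]: "i \<in> Arr C" "r \<in> Arr C" "Src C i = A" "Tgt C i = B"
    "Src C r = B" "Tgt C r = A" and ri: "r \<cdot> i = Ident C A"
    by (rule retractE[OF assms])
  obtain i' where i': "square i' (T i) (syz_incl A) (syz_incl B)"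
    using syz_map[of i] by auto
  obtain r' where r': "square r' (T r) (syz_incl B) (syz_incl A)"
    using syz_map[of r] by auto
  note [simp] = squareD(1)[OF i'] squareD(1)[OF r']
  have [simp]: "Src C i' = syz A" "Tgt C i' = syz B" "Src C r' = syz B" "Tgt C r' = syz A"
    using squareD(5,7)[OF i'] squareD(5,7)[OF r'] by simp_all
  have "syz_incl A \<cdot> (r' \<cdot> i') = T r \<cdot> (T i \<cdot> syz_incl A)"
    by (simp add: square_Comp[OF r'] squareD(9)[OF i'])
  also have "\<dots> = T (r \<cdot> i) \<cdot> syz_incl A"
    by simp
  also have "\<dots> = syz_incl A \<cdot> Ident C (syz A)"
    unfolding ri by simp
  finally have ri': "r' \<cdot> i' = Ident C (syz A)"
    by (rule mono_cancel[OF kernel_mono[OF syz_kernel], rotated 5]) simp_all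
  then show "retract (syz A) (syz B)"
    using retractI[of i' r'] by simp
  assume "S_flat B"
  then show "S_flat A"
    unfolding S_flat_def
    by (intro square_mono_left[OF functor_square[OF functors(1) i'] functor_split_mono[of S i' r']])
      (simp_all add: ri')
qed

lemma cosyz_retract:
  assumes "retract A B"
  shows "retract (cosyz A) (cosyz B)" "mono_arr C (u B) \<Longrightarrow> mono_arr C (u A)"
proof -
  note [simp] = retract_Obj[OF assms]
  obtain i r where [simp]: "i \<in> Arr C" "r \<in> Arr C" "Src C i = A" "Tgt C i = B"
    "Src C r = B" "Tgt C r = A" and ri: "r \<cdot> i = Ident C A"
    by (rule retractE[OF assms])
  obtain i' where i': "square (amap P (amap S i)) i' (cosyz_proj A) (cosyz_proj B)"
    using cosyz_map[of i] by auto
  obtain r' where r': "square (amap P (amap S r)) r' (cosyz_proj B) (cosyz_proj A)"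
    using cosyz_map[of r] by auto
  note [simp] = squareD(2)[OF i'] squareD(2)[OF r']
  have [simp]: "Src C i' = cosyz A" "Tgt C i' = cosyz B" "Src C r' = cosyz B" "Tgt C r' = cosyz A"
    using squareD(6,8)[OF i'] squareD(6,8)[OF r'] by simp_all
  have "(r' \<cdot> i') \<cdot> cosyz_proj A = r' \<cdot> (cosyz_proj B \<cdot> amap P (amap S i))"
    by (simp add: squareD(9)[OF i'])
  also have "\<dots> = cosyz_proj A \<cdot> amap P (amap S (r \<cdot> i))"
    by (simp add: Comp_eq_Comp[OF squareD(9)[OF r', symmetric]])
  also have "\<dots> = Ident C (cosyz A) \<cdot> cosyz_proj A"
    unfolding ri by simp
  finally have ri': "r' \<cdot> i' = Ident C (cosyz A)"
    by (rule epi_cancel[OF cokernel_epi[OF cosyz_cokernel], rotated 5]) simp_all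
  then show "retract (cosyz A) (cosyz B)"
    using retractI[of i' r'] by simp
  have "square i (amap P (amap S i)) (u A) (u B)"
    using u_square[of i] by simp
  moreover have "mono_arr C i"
    by (rule split_mono[of r]) (simp_all add: ri)
  ultimately show "mono_arr C (u B) \<Longrightarrow> mono_arr C (u A)"
    by (rule square_mono_left)
qed

definition relproj :: "'o \<Rightarrow> bool" where
  "relproj Q \<longleftrightarrow> (\<exists>X \<in> Obj C. retract Q (omap P X))"

lemma relproj_P: "X \<in> Obj C \<Longrightarrow> relproj (omap P X)"
  unfolding relproj_def by (intro bexI[of _ X] retract_refl) simp_all

lemma relproj_Obj: "relproj Q \<Longrightarrow> Q \<in> Obj C"
  by (auto simp: relproj_def dest: retract_Obj)

text \<open>
  On \<open>P X\<close> the counit \<open>T (P X) \<rightarrow> P X\<close> is split by \<open>P (h X)\<close>.  Hence \<open>syz (P X)\<close> is a retract of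
  \<open>T (P X) = P (I (P X))\<close>, by a retraction that every functor preserves.
\<close>

lemma syz_relproj:
  assumes "relproj Q"
  shows "S_flat Q" "relproj (syz Q)"
proof -
  obtain X where [simp]: "X \<in> Obj C" and Q: "retract Q (omap P X)"
    using assms by (auto simp: relproj_def)
  obtain r where r: "r \<in> Arr C" "Src C r = omap P (omap I (omap P X))" "Tgt C r = syz (omap P X)"
    "r \<cdot> syz_incl (omap P X) = Ident C (syz (omap P X))"
    by (rule kernel_retraction[OF syz_kernel[of "omap P X"], of "amap P (h X)"])
      (simp_all add: adjunction_triangles[OF PI])
  have "S_flat (omap P X)"
    unfolding S_flat_def using r by (intro functor_split_mono[of S _ r]) simp_all
  then show "S_flat Q"
    by (rule syz_retract(2)[OF Q])
  have "retract (syz (omap P X)) (omap P (omap I (omap P X)))"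
    using retractI[of "syz_incl (omap P X)" r] r by simp
  then show "relproj (syz Q)"
    unfolding relproj_def using syz_retract(1)[OF Q]
    by (intro bexI[of _ "omap I (omap P X)"]) (auto intro: retract_trans)
qed

text \<open>The unit at \<open>P X\<close> is split by \<open>P (c X)\<close>, and its target \<open>P (S (P X))\<close> is again a value of \<open>P\<close>.\<close>

lemma cosyz_relproj:
  assumes "relproj Q"
  shows "mono_arr C (u Q)" "relproj (cosyz Q)"
proof -
  obtain X where [simp]: "X \<in> Obj C" and Q: "retract Q (omap P X)"
    using assms by (auto simp: relproj_def)
  have split: "amap P (c X) \<cdot> u (omap P X) = Ident C (omap P X)"
    using adjunction_triangles(2)[OF SP, of X] by simp
  obtain s where s: "s \<in> Arr C" "Tgt C s = omap P (omap S (omap P X))" "Src C s = cosyz (omap P X)"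
    "cosyz_proj (omap P X) \<cdot> s = Ident C (cosyz (omap P X))"
    by (rule cokernel_section[OF cosyz_cokernel[of "omap P X"], of "amap P (c X)"])
      (simp_all add: split)
  have "mono_arr C (u (omap P X))"
    by (rule split_mono[of "amap P (c X)"]) (simp_all add: split)
  then show "mono_arr C (u Q)"
    by (rule cosyz_retract(2)[OF Q])
  have "retract (cosyz (omap P X)) (omap P (omap S (omap P X)))"
    using retractI[of s "cosyz_proj (omap P X)"] s by simp
  then show "relproj (cosyz Q)"
    unfolding relproj_def using cosyz_retract(1)[OF Q]
    by (intro bexI[of _ "omap S (omap P X)"]) (auto intro: retract_trans)
qed

text \<open>
  The unit is natural and mono on relative projectives, so it detects all subobjects of relative
  projectives.
\<close>

lemma mono_u_if_embeds:
  assumes "mono_arr C f" "relproj (Tgt C f)"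
  shows "mono_arr C (u (Src C f))"
  using square_mono_left[OF u_square assms(1) cosyz_relproj(1)[OF assms(2)]] mono_in_Arr[OF assms(1)]
  by simp

lemma S_u_mono:
  assumes [simp]: "A \<in> Obj C"
  shows "mono_arr C (amap S (u A))"
  by (rule split_mono[of "c (omap S A)"]) (use adjunction_triangles(1)[OF SP, of A] in simp_all)

subsection \<open>Acyclic objects\<close>

text \<open>
  Acyclicity is the vanishing of all higher left derived functors of \<open>S\<close>, the \<open>n\<close>-th one being the first
  one at an iterated syzygy.
\<close>

coinductive S_acyclic :: "'o \<Rightarrow> bool" where
  S_acyclicI: "A \<in> Obj C \<Longrightarrow> S_flat A \<Longrightarrow> S_acyclic (syz A) \<Longrightarrow> S_acyclic A"

lemma S_acyclicD:
  assumes "S_acyclic A"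
  shows "A \<in> Obj C" "S_flat A" "S_acyclic (syz A)"
  using S_acyclic.cases[OF assms] by auto

lemma S_acyclic_relproj: "relproj Q \<Longrightarrow> S_acyclic Q"
  by (coinduction arbitrary: Q) (auto intro: syz_relproj relproj_Obj)

lemma S_acyclic_retract: "retract A B \<Longrightarrow> S_acyclic B \<Longrightarrow> S_acyclic A"
  by (coinduction arbitrary: A B) (blast intro: syz_retract S_acyclicD retract_Obj)

lemma S_acyclic_extension:
  assumes "ses f g" "S_acyclic (Src C f)" "S_acyclic (Tgt C g)"
  shows "S_acyclic (Tgt C f)"
  using assms
proof (coinduction arbitrary: f g)
  case (S_acyclic f g)
  obtain f' g' where "ses f' g'" "Src C f' = syz (Src C f)" "Tgt C f' = syz (Tgt C f)"
    "Tgt C g' = syz (Tgt C g)"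
    by (rule syz_of_ses[OF S_acyclic(1)])
  moreover have "S_flat (Tgt C f)"
    by (rule S_flat_extension) (use S_acyclic S_acyclicD in auto)
  ultimately show ?case
    using S_acyclicD(3)[OF S_acyclic(2)] S_acyclicD(3)[OF S_acyclic(3)] sesD(1)[OF S_acyclic(1)]
    by (metis Tgt_Obj)
qed

lemma S_acyclic_sub:
  assumes "ses f g" "S_acyclic (Tgt C f)" "S_acyclic (Tgt C g)"
  shows "S_acyclic (Src C f)"
  using assms
proof (coinduction arbitrary: f g)
  case (S_acyclic f g)
  obtain f' g' where "ses f' g'" "Src C f' = syz (Src C f)" "Tgt C f' = syz (Tgt C f)"
    "Tgt C g' = syz (Tgt C g)"
    by (rule syz_of_ses[OF S_acyclic(1)])
  moreover have "S_flat (Src C f)"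
    by (rule S_flat_sub[OF S_acyclic(1)]) (use S_acyclic S_acyclicD in auto)
  ultimately show ?case
    using S_acyclicD(3)[OF S_acyclic(2)] S_acyclicD(3)[OF S_acyclic(3)] sesD(1)[OF S_acyclic(1)]
    by (metis Src_Obj)
qed

text \<open>
  A resolution by arbitrary acyclic objects that stays exact under \<open>S\<close>, in contrast to the
  canonical one by the objects \<open>T B\<close> that defines \<^const>\<open>S_acyclic\<close>.  That the two notions agree is dimension
  shifting.
\<close>

coinductive resolved :: "'o \<Rightarrow> bool" where
  resolvedI: "ses f g \<Longrightarrow> mono_arr C (amap S f) \<Longrightarrow> S_acyclic (Tgt C f) \<Longrightarrow> resolved (Src C f) \<Longrightarrow>
    resolved (Tgt C g)"

lemma resolved_S_flat: "resolved A \<Longrightarrow> S_flat A"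
  by (erule resolved.cases) (auto intro: S_flat_quotient S_acyclicD)

lemma resolved_syz: "resolved A \<Longrightarrow> resolved (syz A)"
proof (coinduction arbitrary: A)
  case (resolved A)
  then obtain f g where fg: "ses f g" "mono_arr C (amap S f)" "S_acyclic (Tgt C f)" "resolved (Src C f)"
    and A: "A = Tgt C g"
    by (auto elim: resolved.cases)
  obtain f' g' where 1: "ses f' g'" "Src C f' = syz (Src C f)" "Tgt C f' = syz (Tgt C f)"
    "Tgt C g' = syz (Tgt C g)" and sq: "square f' (T f) (syz_incl (Src C f)) (syz_incl (Tgt C f))"
    by (rule syz_of_ses[OF fg(1)])
  have "mono_arr C (amap S f')"
    by (rule S_mono_syz[OF fg(1,2) resolved_S_flat[OF fg(4)] sq])
  then show ?case
    using 1 A fg(4) S_acyclicD(3)[OF fg(3)] by (intro exI[of _ f'] exI[of _ g']) auto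
qed

lemma resolved_S_acyclic: "resolved A \<Longrightarrow> S_acyclic A"
proof (coinduction arbitrary: A)
  case (S_acyclic A)
  then have "A \<in> Obj C"
    by (cases rule: resolved.cases) (metis sesD(2) Tgt_Obj)
  then show ?case
    using resolved_S_flat[OF S_acyclic] resolved_syz[OF S_acyclic] by blast
qed

lemma S_acyclic_resolved: "S_acyclic A \<Longrightarrow> resolved A"
proof (coinduction arbitrary: A)
  case (resolved A)
  note [simp] = S_acyclicD(1)[OF resolved]
  have "S_acyclic (omap P (omap I A))"
    by (intro S_acyclic_relproj relproj_P) simp
  then show ?case
    using syz_ses[of A] S_acyclicD[OF resolved]
    by (intro exI[of _ "syz_incl A"] exI[of _ "c A"]) (auto simp: S_flat_def)
qed

lemma S_acyclic_quotient:
  assumes "ses f g" "mono_arr C (amap S f)" "S_acyclic (Src C f)" "S_acyclic (Tgt C f)"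
  shows "S_acyclic (Tgt C g)"
  by (rule resolved_S_acyclic[OF resolvedI[OF assms(1,2,4) S_acyclic_resolved[OF assms(3)]]])

lemma S_acyclic_cosyz:
  assumes "S_acyclic A" "mono_arr C (u A)"
  shows "S_acyclic (cosyz A)"
proof -
  note [simp] = S_acyclicD(1)[OF assms(1)]
  have "S_acyclic (omap P (omap S A))"
    by (intro S_acyclic_relproj relproj_P) simp
  then show ?thesis
    using S_acyclic_quotient[OF cosyz_ses[OF _ assms(2)] S_u_mono] assms(1) by simp
qed

subsection \<open>Iterated embeddings into relative projectives\<close>

text \<open>
  The unit \<open>B \<rightarrow> P (S B)\<close> is the universal arrow from \<open>B\<close> to a value of \<open>P\<close>.  The condition says that the
  canonical coresolution \<open>A \<rightarrow> P (S A) \<rightarrow> P (S (cosyz A)) \<rightarrow> \<dots>\<close> is exact.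
\<close>

coinductive embedded :: "'o \<Rightarrow> bool" where
  embeddedI: "A \<in> Obj C \<Longrightarrow> mono_arr C (u A) \<Longrightarrow> embedded (cosyz A) \<Longrightarrow> embedded A"

lemma embeddedD:
  assumes "embedded A"
  shows "A \<in> Obj C" "mono_arr C (u A)" "embedded (cosyz A)"
  using embedded.cases[OF assms] by auto

lemma embedded_relproj: "relproj Q \<Longrightarrow> embedded Q"
  by (coinduction arbitrary: Q) (auto intro: cosyz_relproj relproj_Obj)

lemma embedded_retract: "retract A B \<Longrightarrow> embedded B \<Longrightarrow> embedded A"
  by (coinduction arbitrary: A B) (blast intro: cosyz_retract embeddedD retract_Obj)

text \<open>
  Acyclicity of the last object keeps \<open>S\<close>, and hence \<open>P \<circ> S\<close>, exact on the sequence; it is inherited by the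
  cosyzygy, so that the argument can be repeated.
\<close>

lemma embedded_extension:
  assumes "ses f g" "embedded (Src C f)" "embedded (Tgt C g)" "S_acyclic (Tgt C g)"
  shows "embedded (Tgt C f)"
  using assms
proof (coinduction arbitrary: f g)
  case (embedded f g)
  note [simp] = sesD(1-3)[OF embedded(1)]
  have S: "mono_arr C (amap S f)"
    by (rule S_mono_if_flat[OF embedded(1) S_acyclicD(2)[OF embedded(4)]])
  obtain f' g' where 1: "ses f' g'" "Src C f' = cosyz (Src C f)" "Tgt C f' = cosyz (Tgt C f)"
    "Tgt C g' = cosyz (Tgt C g)"
    by (rule cosyz_of_ses[OF embedded(1) S embeddedD(2)[OF embedded(3)]])
  have "mono_arr C (u (Tgt C f))"
    by (rule four_lemma_mono[OF u_square _ sesD(8)[OF embedded(1)]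
          sesD(5)[OF P_ses[OF S_mono_ses[OF embedded(1) S]]] embeddedD(2)[OF embedded(2)]
          embeddedD(2)[OF embedded(3)]])
      (use u_square[of g] in simp_all)
  then show ?case
    using 1 embeddedD(3)[OF embedded(2)] embeddedD(3)[OF embedded(3)]
      S_acyclic_cosyz[OF embedded(4) embeddedD(2)[OF embedded(3)]] sesD(1)[OF embedded(1)]
    by (metis Tgt_Obj)
qed

lemma embedded_sub:
  assumes "ses f g" "embedded (Tgt C f)" "embedded (Tgt C g)" "S_acyclic (Tgt C g)"
  shows "embedded (Src C f)"
  using assms
proof (coinduction arbitrary: f g)
  case (embedded f g)
  have S: "mono_arr C (amap S f)"
    by (rule S_mono_if_flat[OF embedded(1) S_acyclicD(2)[OF embedded(4)]])
  obtain f' g' where 1: "ses f' g'" "Src C f' = cosyz (Src C f)" "Tgt C f' = cosyz (Tgt C f)"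
    "Tgt C g' = cosyz (Tgt C g)"
    by (rule cosyz_of_ses[OF embedded(1) S embeddedD(2)[OF embedded(3)]])
  have "mono_arr C (u (Src C f))"
    by (rule square_mono_left[OF u_square sesD(5)[OF embedded(1)] embeddedD(2)[OF embedded(2)]])
      (rule sesD[OF embedded(1)])
  then show ?case
    using 1 embeddedD(3)[OF embedded(2)] embeddedD(3)[OF embedded(3)]
      S_acyclic_cosyz[OF embedded(4) embeddedD(2)[OF embedded(3)]] sesD(1)[OF embedded(1)]
    by (metis Src_Obj)
qed

text \<open>
  The right half of a complete resolution, with arbitrary relative projectives in place of the
  objects \<open>P (S B)\<close>.
\<close>

coinductive coresolved :: "'o \<Rightarrow> bool" where
  coresolvedI: "ses f g \<Longrightarrow> mono_arr C (amap S f) \<Longrightarrow> relproj (Tgt C f) \<Longrightarrow> coresolved (Tgt C g) \<Longrightarrow>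
    coresolved (Src C f)"

lemma coresolved_mono_u: "coresolved A \<Longrightarrow> mono_arr C (u A)"
  by (erule coresolved.cases) (auto intro: mono_u_if_embeds sesD)

text \<open>
  Applying \<open>cosyz\<close> to a short exact sequence of the coresolution gives one of the same kind; that \<open>S\<close>
  keeps it exact follows from acyclicity, which passes from \<open>A\<close> to the next cycle and to its cosyzygy.
\<close>

lemma coresolved_cosyz: "coresolved A \<Longrightarrow> S_acyclic A \<Longrightarrow> coresolved (cosyz A)"
proof (coinduction arbitrary: A)
  case (coresolved A)
  then obtain f g where fg: "ses f g" "mono_arr C (amap S f)" "relproj (Tgt C f)" "coresolved (Tgt C g)"
    and A: "A = Src C f"
    by (auto elim: coresolved.cases)
  note u = coresolved_mono_u[OF fg(4)]
  obtain f' g' where 1: "ses f' g'" "Src C f' = cosyz (Src C f)" "Tgt C f' = cosyz (Tgt C f)"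
    "Tgt C g' = cosyz (Tgt C g)"
    by (rule cosyz_of_ses[OF fg(1,2) u])
  have ac: "S_acyclic (Tgt C g)"
    using coresolved(2) A by (intro S_acyclic_quotient[OF fg(1,2)] S_acyclic_relproj[OF fg(3)]) simp
  have "mono_arr C (amap S f')"
    using S_acyclicD(2)[OF S_acyclic_cosyz[OF ac u]] 1(4) by (intro S_mono_if_flat[OF 1(1)]) simp
  then show ?case
    using 1 A fg(4) ac cosyz_relproj(2)[OF fg(3)] by (intro exI[of _ f'] exI[of _ g']) auto
qed

lemma coresolved_embedded: "coresolved A \<Longrightarrow> S_acyclic A \<Longrightarrow> embedded A"
proof (coinduction arbitrary: A)
  case (embedded A)
  note A = S_acyclicD(1)[OF embedded(2)] coresolved_mono_u[OF embedded(1)]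
  show ?case
    using A coresolved_cosyz[OF embedded] S_acyclic_cosyz[OF embedded(2) A(2)] by blast
qed

end

section \<open>Splicing short exact sequences\<close>

context abelian_category
begin

lemma cycle_ses:
  assumes "exact_at C f g" and k: "is_kernel C k f" and l: "is_kernel C l g"
  obtains p where "ses k p" "Tgt C p = Src C l" "l \<cdot> p = f"
proof -
  obtain p where p: "p \<in> Arr C" "Tgt C p = Src C l" "l \<cdot> p = f" "epi_arr C p"
    by (rule exact_at_factor[OF assms(1) l])
  have "is_kernel C k p"
    using k kernel_Comp_mono[OF kernel_mono[OF l], of p k] p by simp
  then show thesis
    using that[of p] p ses_if_epi by blast
qed

lemma cycle_cokernel:
  assumes "exact_at C e f" "exact_at C f g" and l: "is_kernel C l g"
  obtains p where "p \<in> Arr C" "is_cokernel C p e" "Tgt C p = Src C l" "l \<cdot> p = f"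
proof -
  have "f \<in> Arr C"
    using assms(1) by (auto simp: exact_at_def is_kernel_def)
  then obtain k where k: "is_kernel C k f"
    using kernel_exists by blast
  obtain p where p: "ses k p" "Tgt C p = Src C l" "l \<cdot> p = f"
    by (rule cycle_ses[OF assms(2) k l])
  obtain q where q: "q \<in> Arr C" "Tgt C q = Src C k" "k \<cdot> q = e" "epi_arr C q"
    by (rule exact_at_factor[OF assms(1) k])
  have "is_cokernel C p e"
    using cokernel_Comp_epi[of q k p] q(2,4) sesD[OF p(1)] by (simp add: q(3))
  then show thesis
    using that p sesD(2)[OF p(1)] by blast
qed

text \<open>
  The cycle object \<open>Src l\<close> is the cokernel of \<open>e\<close>, which a right exact functor preserves; so exactness
  of the transformed sequence says that \<open>F l\<close> is mono.
\<close>

lemma functor_mono_cycle: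
  assumes F: "additive_functor C F"
    and F_coker: "\<And>q f. is_cokernel C q f \<Longrightarrow> is_cokernel C (amap F q) (amap F f)"
    and "exact_at C e f" "exact_at C f g" and l: "is_kernel C l g"
    and ex: "exact_at C (amap F e) (amap F f)"
  shows "mono_arr C (amap F l)"
proof -
  obtain p where p [simp]: "p \<in> Arr C" "Tgt C p = Src C l" and pe: "is_cokernel C p e" and lp: "l \<cdot> p = f"
    by (rule cycle_cokernel[OF assms(3,4) l])
  note [simp] = F is_kernelD(1)[OF l] is_cokernelD[OF pe]
  note Fp = F_coker[OF pe]
  have Ff: "amap F f = amap F l \<cdot> amap F p"
    by (simp flip: lp)
  show ?thesis
    unfolding mono_arr_iff
  proof (intro conjI ballI impI)
    fix x assume x [simp]: "x \<in> Arr C" "Tgt C x = Src C (amap F l)"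
      and 0: "amap F l \<cdot> x = Zero C (Src C x) (Tgt C (amap F l))"
    obtain d y where d [simp]: "d \<in> Arr C" "epi_arr C d" "Tgt C d = Src C x"
      "y \<in> Arr C" "Src C y = Src C d" "Tgt C y = omap F (Src C p)" and xd: "x \<cdot> d = amap F p \<cdot> y"
      by (rule epi_lift[OF cokernel_epi[OF Fp], of x]) simp_all
    have "amap F l \<cdot> (amap F p \<cdot> y) = Zero C (Src C y) (omap F (Tgt C l))"
      using 0 by (simp add: Comp_eq[OF 0] flip: xd)
    then have 1: "amap F f \<cdot> y = Zero C (Src C y) (Tgt C (amap F f))"
      unfolding Ff by simp
    have "Tgt C y = Src C (amap F f)"
      unfolding Ff by simp
    then obtain d' z where d' [simp]: "d' \<in> Arr C" "epi_arr C d'" "Tgt C d' = Src C y"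
      "z \<in> Arr C" "Src C z = Src C d'" "Tgt C z = Src C (amap F e)" and yd: "y \<cdot> d' = amap F e \<cdot> z"
      by (rule exact_at_cover[OF ex d(4) _ 1])
    have "x \<cdot> (d \<cdot> d') = amap F p \<cdot> (y \<cdot> d')"
      by (simp add: Comp_eq_Comp[OF xd])
    also have "\<dots> = Zero C (Src C (d \<cdot> d')) (Tgt C x)"
      unfolding yd by (simp add: Comp_eq[OF is_cokernelD(4)[OF Fp]])
    finally show "x = Zero C (Src C x) (Src C (amap F l))"
      using epi_Zero[of "d \<cdot> d'" x] by (simp add: epi_Comp)
  qed simp
qed

text \<open>The complement is a zero object.\<close>

lemma direct_summand_refl:
  assumes [simp]: "A \<in> Obj C"
  shows "direct_summand C A A"
proof -
  obtain Z where Z: "zero_object C Z"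
    using zero_object_exists by blast
  note [simp] = zero_objectD[OF Z]
  have "is_biproduct C A A Z (Ident C A) (Zero C Z A) (Ident C A) (Zero C A Z)"
    by (simp add: is_biproduct_def Hom_def)
  then show ?thesis
    unfolding direct_summand_def by (intro bexI[of _ Z]) auto
qed

subsection \<open>Reversal of exact sequences\<close>

lemma exact_at_composable: "exact_at C f g \<Longrightarrow> f \<in> Arr C \<and> g \<in> Arr C \<and> Tgt C f = Src C g"
  by (auto simp: exact_at_def is_image_def is_kernel_def is_cokernel_def)

text \<open>
  Reversing the arrows of an exact sequence turns the kernel of \<open>s 0\<close> into a cokernel: it is the
  cokernel of \<open>s 2\<close>, which explains the index shift in the reversed sequence.
\<close>

lemma gorenstein_projectives_opposite_subset:
  "gorenstein_projectives C Q F \<subseteq> gorenstein_projectives (opposite C) Q F"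
proof
  fix A assume "A \<in> gorenstein_projectives C Q F"
  then obtain s k where A: "A \<in> Obj C" and s: "exact_sequence C s" "exact_sequence C (\<lambda>i. amap F (s i))"
    and Q: "\<And>i. relative_projective C Q (Src C (s i))"
    and k: "is_kernel C k (s 0)" "Src C k = A"
    by (auto simp: gorenstein_projectives_def)
  have ex: "exact_at C (s (i + 1)) (s i)" "exact_at C (amap F (s (i + 1))) (amap F (s i))" for i
    using s by (auto simp: exact_sequence_def)
  have "exact_at C (s 2) (s 1)" "exact_at C (s 1) (s 0)"
    using ex(1)[of 0] ex(1)[of 1] by simp_all
  then obtain p where p: "is_cokernel C p (s 2)" "Tgt C p = A"
    using cycle_cokernel[OF _ _ k(1)] k(2) by metis
  define t where "t i = s (2 - i)" for i
  have "exact_sequence (opposite C) t" "exact_sequence (opposite C) (\<lambda>i. amap F (t i))"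
    using exact_at_opposite[OF ex(1)[of "1 - _"]] exact_at_opposite[OF ex(2)[of "1 - _"]]
    by (simp_all add: exact_sequence_def t_def)
  moreover have "relative_projective (opposite C) Q (Src (opposite C) (t i))" for i
    using Q[of "1 - i"] exact_at_composable[OF ex(1)[of "1 - i"]]
    by (simp add: relative_projective_def t_def)
  moreover have "is_kernel (opposite C) p (t 0)" "Src (opposite C) p = A"
    using p by (simp_all add: t_def)
  ultimately show "A \<in> gorenstein_projectives (opposite C) Q F"
    using A by (auto simp: gorenstein_projectives_def)
qed

end

lemma gorenstein_injectives_eq_opposite:
  assumes "abelian_category C"
  shows "gorenstein_injectives C Q F = gorenstein_projectives (opposite C) Q F"
proof -
  have "gorenstein_injectives C Q F = gorenstein_projectives C Q F"
    by (simp add: gorenstein_injectives_def gorenstein_projectives_def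
        relative_injective_def relative_projective_def)
  also have "\<dots> = gorenstein_projectives (opposite C) Q F"
    using abelian_category.gorenstein_projectives_opposite_subset[OF assms]
      abelian_category.gorenstein_projectives_opposite_subset[OF abelian_opposite[OF assms]]
    by (metis opposite_simps(11) subset_antisym)
  finally show ?thesis .
qed

lemma coresolving_if_resolving_opposite:
  assumes C: "abelian_category C" and res: "resolving (opposite C) X"
  shows "coresolving C X"
proof -
  interpret abelian_category C by fact
  have ext: "Tgt (opposite C) f \<in> X"
    if "short_exact (opposite C) f g" "Src (opposite C) f \<in> X" "Tgt (opposite C) g \<in> X" for f g
    using res that unfolding resolving_def closed_under_extensions_def by blast
  have "Tgt C f \<in> X" if "short_exact C f g" "Src C f \<in> X" "Tgt C g \<in> X" for f g
  proof -
    have "short_exact (opposite C) g f"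
      using that(1) exact_at_opposite by (auto simp: short_exact_def)
    then have "Src C g \<in> X"
      using ext[of g f] that(2,3) by simp
    then show ?thesis
      using sesD(3)[OF ses_if_short_exact[OF that(1)]] by simp
  qed
  moreover have "X \<subseteq> Obj C" "\<forall>A \<in> Obj C. \<exists>B \<in> X. \<exists>f \<in> Hom C A B. mono_arr C f"
    "closed_under_summands C X"
    "\<forall>f q. mono_arr C f \<and> Tgt C f \<in> X \<and> Src C f \<in> X \<and> is_cokernel C q f \<longrightarrow> Tgt C q \<in> X"
    using res by (simp_all add: resolving_def closed_under_summands_def)
  ultimately show ?thesis
    unfolding coresolving_def closed_under_extensions_def by blast
qed

section \<open>Gorenstein projective objects\<close>

context adjoint_triple
begin

text \<open>By naturality of the counit, \<open>f \<cdot> c\<close> factors through \<open>S (P f)\<close>; and \<open>c\<close> is epi.\<close>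

lemma P_faithful:
  assumes [simp]: "f \<in> Arr C" and 0: "amap P f = Zero C (omap P (Src C f)) (omap P (Tgt C f))"
  shows "f = Zero C (Src C f) (Tgt C f)"
proof -
  have "f \<cdot> c (Src C f) = c (Tgt C f) \<cdot> amap S (amap P f)"
    using counit_natural[OF SP, of f] by simp
  also have "\<dots> = Zero C (omap P (omap I (Src C f))) (Tgt C f)"
    unfolding 0 by simp
  finally show ?thesis
    using epi_Zero[OF epi_c, of "Src C f" f] by simp
qed

lemma P_mono_iff:
  assumes [simp]: "f \<in> Arr C"
  shows "mono_arr C (amap P f) \<longleftrightarrow> mono_arr C f"
proof
  assume m: "mono_arr C (amap P f)"
  show "mono_arr C f"
    unfolding mono_arr_iff
  proof (intro conjI ballI impI)
    fix x assume [simp]: "x \<in> Arr C" "Tgt C x = Src C f" and 0: "f \<cdot> x = Zero C (Src C x) (Tgt C f)"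
    have "amap P f \<cdot> amap P x = amap P (f \<cdot> x)"
      by simp
    also have "\<dots> = Zero C (Src C (amap P x)) (Tgt C (amap P f))"
      unfolding 0 by simp
    finally have "amap P x = Zero C (Src C (amap P x)) (Src C (amap P f))"
      by (intro mono_Zero[OF m]) simp_all
    then show "x = Zero C (Src C x) (Src C f)"
      using P_faithful[of x] by simp
  qed simp
next
  assume "mono_arr C f"
  moreover obtain q where "is_cokernel C q f"
    using cokernel_exists[of f] by auto
  ultimately show "mono_arr C (amap P f)"
    using sesD(5)[OF P_ses[OF ses_if_mono]] by blast
qed

lemma mono_h:
  assumes [simp]: "A \<in> Obj C"
  shows "mono_arr C (h A)"
proof -
  have "mono_arr C (amap P (h A))"
    by (rule split_mono[of "c (omap P A)"]) (simp_all add: adjunction_triangles[OF PI])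
  then show ?thesis
    using P_mono_iff[of "h A"] by simp
qed

text \<open>
  Cycles in positive degrees are the iterated syzygies of \<open>A\<close> and cycles in negative degrees its iterated
  cosyzygies.
\<close>

lemma complete_resolution:
  assumes "S_acyclic A" "embedded A"
  obtains k p where "\<And>i::int. ses (k i) (p i)" "\<And>i. mono_arr C (amap S (k i))"
    "\<And>i. \<exists>X \<in> Obj C. Tgt C (k i) = omap P X" "\<And>i. Tgt C (p i) = Src C (k (i - 1))" "Src C (k 0) = A"
proof -
  define Z where "Z i = (if 0 \<le> i then (syz ^^ nat i) A else (cosyz ^^ nat (- i)) A)" for i :: int
  have neg: "S_acyclic ((cosyz ^^ n) A) \<and> embedded ((cosyz ^^ n) A)" for n
    by (induction n) (auto simp: assms S_acyclic_cosyz embeddedD)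
  have pos: "S_acyclic ((syz ^^ n) A)" for n
    by (induction n) (auto simp: assms S_acyclicD)
  have Z_pos: "Z i = syz (Z (i - 1))" if "i > 0" for i
  proof -
    have "nat i = Suc (nat (i - 1))"
      using that by simp
    then show ?thesis
      using that by (simp add: Z_def)
  qed
  have Z_neg: "Z (i - 1) = cosyz (Z i)" if "i \<le> 0" for i
  proof -
    have "nat (- (i - 1)) = Suc (nat (- i))"
      using that by simp
    then show ?thesis
      using that by (auto simp: Z_def)
  qed
  have ac: "S_acyclic (Z i)" for i
    using pos neg by (simp add: Z_def)
  have em: "embedded (Z i)" if "i \<le> 0" for i
    using neg[of 0] neg that by (auto simp: Z_def)
  note [simp] = S_acyclicD(1)[OF ac]
  define k where "k i = (if i > 0 then syz_incl (Z (i - 1)) else u (Z i))" for i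
  define p where "p i = (if i > 0 then c (Z (i - 1)) else cosyz_proj (Z i))" for i
  have Src_k: "Src C (k i) = Z i" for i
    by (simp add: k_def Z_pos)
  show thesis
  proof (rule that[of k p])
    show "ses (k i) (p i)" for i
      using syz_ses cosyz_ses embeddedD(2)[OF em] by (simp add: k_def p_def)
    show "mono_arr C (amap S (k i))" for i
      using S_acyclicD(2)[OF ac] S_u_mono by (simp add: k_def S_flat_def)
    show "\<exists>X \<in> Obj C. Tgt C (k i) = omap P X" for i
      by (cases "i > 0") (auto simp: k_def intro: bexI[of _ "omap I (Z (i - 1))"] bexI[of _ "omap S (Z i)"])
    show "Tgt C (p i) = Src C (k (i - 1))" for i
      unfolding Src_k by (simp add: p_def Z_neg)
    show "Src C (k 0) = A"
      unfolding Src_k by (simp add: Z_def)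
  qed
qed

text \<open>
  The sequence and its cycles carry the same information: for a right exact functor \<open>F\<close>, exactness of the
  image sequence means that \<open>F\<close> keeps the inclusions of the cycles mono, and this can be tested
  after applying the faithful exact functor \<open>P\<close>.
\<close>

lemma gorenstein_projectives_eq:
  assumes F: "additive_functor C F" and S: "S = P \<circ>\<^sub>F F"
    and F_coker: "\<And>q f. is_cokernel C q f \<Longrightarrow> is_cokernel C (amap F q) (amap F f)"
  shows "gorenstein_projectives C P F = {A. S_acyclic A \<and> embedded A}"
proof (intro equalityI subsetI CollectI)
  have mono_iff: "mono_arr C (amap S f) \<longleftrightarrow> mono_arr C (amap F f)" if "f \<in> Arr C" for f
    using P_mono_iff[of "amap F f"] that F by (simp add: S comp_functor_def)
  {
    fix A assume "A \<in> gorenstein_projectives C P F"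
    then obtain s k0 where s: "exact_sequence C s" "exact_sequence C (\<lambda>i. amap F (s i))"
      and "\<And>i. relative_projective C P (Src C (s i))"
      and k0: "is_kernel C k0 (s 0)" "Src C k0 = A"
      by (auto simp: gorenstein_projectives_def)
    then have proj: "relproj (Src C (s i))" for i
      unfolding relative_projective_def relproj_def using direct_summand_retract by blast
    have ex: "exact_at C (s (i + 1)) (s i)" "exact_at C (amap F (s (i + 1))) (amap F (s i))" for i
      using s by (auto simp: exact_sequence_def)
    have "\<exists>k. is_kernel C k (s i) \<and> (i = 0 \<longrightarrow> k = k0)" for i
      using kernel_exists[of "s i"] exact_at_composable[OF ex(1)[of i]] k0(1) by (cases "i = 0") auto
    then obtain k where k: "\<And>i. is_kernel C (k i) (s i)" and "k 0 = k0"
      by metis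
    have monok: "mono_arr C (amap S (k i))" for i
      unfolding mono_iff[OF is_kernelD(1)[OF k]]
      using functor_mono_cycle[OF F F_coker ex(1) _ k ex(2), of "i + 1"] ex(1)[of i] by simp
    have seq: "\<exists>p. ses (k (i + 1)) p \<and> Tgt C p = Src C (k i)" for i
      by (rule cycle_ses[OF ex(1)[of i] k k]) blast
    have projk: "relproj (Tgt C (k i))" for i
      using proj[of i] is_kernelD(3)[OF k] by simp
    have "resolved (Src C (k i))" for i
    proof (coinduction arbitrary: i)
      case resolved
      then show ?case
        using seq[of i] monok[of "i + 1"] S_acyclic_relproj[OF projk[of "i + 1"]] by metis
    qed
    then have ac: "S_acyclic (Src C (k i))" for i
      by (rule resolved_S_acyclic)
    have "coresolved (Src C (k i))" for i
    proof (coinduction arbitrary: i)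
      case coresolved
      then show ?case
        using seq[of "i - 1"] monok[of i] projk[of i] by (metis diff_add_cancel)
    qed
    then have "embedded (Src C (k 0))"
      using ac by (intro coresolved_embedded)
    then show "S_acyclic A \<and> embedded A"
      using ac[of 0] k0 \<open>k 0 = k0\<close> by simp
  next
    fix A assume "A \<in> {A. S_acyclic A \<and> embedded A}"
    then have A: "S_acyclic A" "embedded A"
      by auto
    obtain k p where kp: "\<And>i::int. ses (k i) (p i)" "\<And>i. mono_arr C (amap S (k i))"
      "\<And>i. \<exists>X \<in> Obj C. Tgt C (k i) = omap P X" "\<And>i. Tgt C (p i) = Src C (k (i - 1))" "Src C (k 0) = A"
      by (rule complete_resolution[OF A]) blast
    note [simp] = sesD(1-3)[OF kp(1)] kp(4) F
    have Fses: "ses (amap F (k i)) (amap F (p i))" for i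
      using kp(2)[of i] by (intro ses_if_mono F_coker sesD(8)[OF kp(1)]) (simp add: mono_iff)
    define s where "s i = k (i - 1) \<cdot> p i" for i
    have "exact_at C (s (i + 1)) (s i)" for i
      unfolding s_def using exact_at_splice[OF kp(1)[of i] sesD(6)[OF kp(1)[of "i + 1"]] sesD(5)[OF kp(1)[of "i - 1"]]]
      by simp
    moreover have "exact_at C (amap F (s (i + 1))) (amap F (s i))" for i
      unfolding s_def using exact_at_splice[OF Fses[of i] sesD(6)[OF Fses[of "i + 1"]] sesD(5)[OF Fses[of "i - 1"]]]
      by simp
    moreover have "relative_projective C P (Src C (s i))" for i
    proof -
      obtain X where [simp]: "X \<in> Obj C" and X: "Tgt C (k i) = omap P X"
        using kp(3)[of i] by blast
      have "direct_summand C (omap P X) (omap P X)"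
        by (rule direct_summand_refl) simp
      then show ?thesis
        by (auto simp: relative_projective_def s_def X)
    qed
    moreover have "is_kernel C (k 0) (s 0)"
      using kernel_Comp_mono[OF sesD(5)[OF kp(1)[of "- 1"]], of "p 0" "k 0"] sesD(7)[OF kp(1)[of 0]]
      by (simp add: s_def)
    ultimately show "A \<in> gorenstein_projectives C P F"
      using kp(5) S_acyclicD(1)[OF A(1)] by (auto simp: gorenstein_projectives_def exact_sequence_def)
  }
qed

lemma resolving_S_acyclic_embedded: "resolving C {A. S_acyclic A \<and> embedded A}"
  unfolding resolving_def closed_under_summands_def closed_under_extensions_def
proof (intro conjI allI ballI impI)
  show "{A. S_acyclic A \<and> embedded A} \<subseteq> Obj C"
    by (auto dest: S_acyclicD)
next
  fix A assume [simp]: "A \<in> Obj C"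
  have "relproj (omap P (omap I A))"
    by (intro relproj_P) simp
  then show "\<exists>B \<in> {A. S_acyclic A \<and> embedded A}. \<exists>f \<in> Hom C B A. epi_arr C f"
    using epi_c[of A]
    by (intro bexI[of _ "omap P (omap I A)"] bexI[of _ "c A"])
      (auto simp: Hom_def S_acyclic_relproj embedded_relproj)
next
  fix S A assume "S \<in> {A. S_acyclic A \<and> embedded A}" "direct_summand C A S"
  then show "A \<in> {A. S_acyclic A \<and> embedded A}"
    using S_acyclic_retract embedded_retract direct_summand_retract by blast
next
  fix f g assume *: "short_exact C f g \<and> Src C f \<in> {A. S_acyclic A \<and> embedded A} \<and>
    Tgt C g \<in> {A. S_acyclic A \<and> embedded A}"
  then have "ses f g"
    by (simp add: ses_if_short_exact)
  then show "Tgt C f \<in> {A. S_acyclic A \<and> embedded A}"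
    using * S_acyclic_extension embedded_extension by blast
next
  fix f k assume *: "epi_arr C f \<and> Src C f \<in> {A. S_acyclic A \<and> embedded A} \<and>
    Tgt C f \<in> {A. S_acyclic A \<and> embedded A} \<and> is_kernel C k f"
  then have "ses k f" "Src C f = Tgt C k"
    using ses_if_epi is_kernelD(3) by auto
  then show "Src C k \<in> {A. S_acyclic A \<and> embedded A}"
    using * S_acyclic_sub embedded_sub by auto
qed

end

section \<open>Nakayama functors\<close>

text \<open>
  The adjunction \<open>P \<stileturn> \<nu> \<circ> P\<close> is part of the data here, so that its unit and counit have names.
\<close>

locale nakayama = abelian_category C
  for C :: "('o, 'm) precategory" (structure) +
  fixes P \<nu> \<nu>' :: "('o, 'm) endofunctor" and \<eta> \<epsilon> h c :: "'o \<Rightarrow> 'm"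
  assumes generating: "generating_functor C P"
    and adj: "adjunction C \<nu> \<nu>' \<eta> \<epsilon>"
    and adj_P: "adjunction C P (\<nu> \<circ>\<^sub>F P) h c"
    and iso: "A \<in> Obj C \<Longrightarrow> iso_arr C (\<eta> (omap P A))"
begin

lemmas nakayama_functors [simp] = adjunction_functors[OF adj] adjunction_functors[OF adj_P]
lemmas \<eta>_arr [simp] = adjunction_unit[OF adj]
lemmas \<epsilon>_arr [simp] = adjunction_counit[OF adj]

lemma comp_functor_simps [simp]:
  "omap (G \<circ>\<^sub>F F) A = omap G (omap F A)" "amap (G \<circ>\<^sub>F F) f = amap G (amap F f)"
  by (simp_all add: comp_functor_def)

lemma h_arr' [simp]:
  assumes "A \<in> Obj C"
  shows "h A \<in> Arr C" "Src C (h A) = A" "Tgt C (h A) = omap \<nu> (omap P (omap P A))"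
  using adjunction_unit[OF adj_P assms] by simp_all

lemma c_arr' [simp]:
  assumes "A \<in> Obj C"
  shows "c A \<in> Arr C" "Tgt C (c A) = A" "Src C (c A) = omap P (omap \<nu> (omap P A))"
  using adjunction_counit[OF adj_P assms] by simp_all

definition \<eta>_inv :: "'o \<Rightarrow> 'm" where
  "\<eta>_inv A = (SOME g. g \<in> Hom C (omap \<nu>' (omap \<nu> (omap P A))) (omap P A) \<and>
    g \<cdot> \<eta> (omap P A) = Ident C (omap P A) \<and>
    \<eta> (omap P A) \<cdot> g = Ident C (omap \<nu>' (omap \<nu> (omap P A))))"

lemma \<eta>_inv:
  assumes [simp]: "A \<in> Obj C"
  shows "\<eta>_inv A \<in> Arr C" "Src C (\<eta>_inv A) = omap \<nu>' (omap \<nu> (omap P A))" "Tgt C (\<eta>_inv A) = omap P A"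
    "\<eta>_inv A \<cdot> \<eta> (omap P A) = Ident C (omap P A)"
    "\<eta> (omap P A) \<cdot> \<eta>_inv A = Ident C (omap \<nu>' (omap \<nu> (omap P A)))"
proof -
  have "\<exists>g. g \<in> Hom C (omap \<nu>' (omap \<nu> (omap P A))) (omap P A) \<and>
    g \<cdot> \<eta> (omap P A) = Ident C (omap P A) \<and>
    \<eta> (omap P A) \<cdot> g = Ident C (omap \<nu>' (omap \<nu> (omap P A)))"
    using iso[of A] by (auto simp: iso_arr_def)
  from someI_ex[OF this, folded \<eta>_inv_def]
  show "\<eta>_inv A \<in> Arr C" "Src C (\<eta>_inv A) = omap \<nu>' (omap \<nu> (omap P A))" "Tgt C (\<eta>_inv A) = omap P A"
    "\<eta>_inv A \<cdot> \<eta> (omap P A) = Ident C (omap P A)"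
    "\<eta> (omap P A) \<cdot> \<eta>_inv A = Ident C (omap \<nu>' (omap \<nu> (omap P A)))"
    by (auto simp: Hom_def)
qed

lemmas [simp] = \<eta>_inv(1-3)

lemma \<eta>_P_mono: "A \<in> Obj C \<Longrightarrow> mono_arr C (\<eta> (omap P A))"
  by (rule split_mono[of "\<eta>_inv A"]) (simp_all add: \<eta>_inv)

text \<open>
  The unit of the composite of \<open>\<nu> \<stileturn> \<nu>'\<close> and \<open>P \<stileturn> \<nu> \<circ> P\<close>, moved from \<open>\<nu>' \<circ> \<nu> \<circ> P\<close> to \<open>P\<close> along the inverse
  of \<open>\<eta>\<close>.
\<close>

definition u :: "'o \<Rightarrow> 'm" where
  "u A = \<eta>_inv (omap P (omap \<nu> A)) \<cdot> (amap \<nu>' (h (omap \<nu> A)) \<cdot> \<eta> A)"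

lemma u_arr [simp]:
  assumes "A \<in> Obj C"
  shows "u A \<in> Arr C" "Src C (u A) = A" "Tgt C (u A) = omap P (omap P (omap \<nu> A))"
  using assms by (simp_all add: u_def)

lemma \<eta>_u:
  assumes [simp]: "A \<in> Obj C"
  shows "\<eta> (omap P (omap P (omap \<nu> A))) \<cdot> u A = amap \<nu>' (h (omap \<nu> A)) \<cdot> \<eta> A"
  by (simp add: u_def Comp_eq[OF \<eta>_inv(5)])

lemma \<nu>_\<eta>_inv:
  assumes [simp]: "A \<in> Obj C"
  shows "amap \<nu> (\<eta>_inv A) = \<epsilon> (omap \<nu> (omap P A))"
proof -
  let ?X = "omap P A"
  have "amap \<nu> (\<eta>_inv A) = (\<epsilon> (omap \<nu> ?X) \<cdot> amap \<nu> (\<eta> ?X)) \<cdot> amap \<nu> (\<eta>_inv A)"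
    by (simp add: adjunction_triangles(1)[OF adj] del: Comp_Comp)
  also have "\<dots> = \<epsilon> (omap \<nu> ?X) \<cdot> amap \<nu> (\<eta> ?X \<cdot> \<eta>_inv A)"
    by simp
  also have "\<dots> = \<epsilon> (omap \<nu> ?X)"
    by (simp add: \<eta>_inv(5) del: functor_Comp)
  finally show ?thesis .
qed

lemma \<nu>_u:
  assumes [simp]: "A \<in> Obj C"
  shows "amap \<nu> (u A) = h (omap \<nu> A)"
proof -
  have nat: "\<epsilon> (omap \<nu> (omap P (omap P (omap \<nu> A)))) \<cdot> amap \<nu> (amap \<nu>' (h (omap \<nu> A)))
      = h (omap \<nu> A) \<cdot> \<epsilon> (omap \<nu> A)"
    using counit_natural[OF adj, of "h (omap \<nu> A)"] by simp
  have "amap \<nu> (u A) = \<epsilon> (omap \<nu> (omap P (omap P (omap \<nu> A)))) \<cdot>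
      (amap \<nu> (amap \<nu>' (h (omap \<nu> A))) \<cdot> amap \<nu> (\<eta> A))"
    by (simp add: u_def \<nu>_\<eta>_inv)
  also have "\<dots> = h (omap \<nu> A) \<cdot> (\<epsilon> (omap \<nu> A) \<cdot> amap \<nu> (\<eta> A))"
    by (simp add: Comp_eq_Comp[OF nat])
  finally show ?thesis
    by (simp add: adjunction_triangles(1)[OF adj])
qed

lemma P_\<nu>_P: "(P \<circ>\<^sub>F \<nu>) \<circ>\<^sub>F P = P \<circ>\<^sub>F (\<nu> \<circ>\<^sub>F P)"
  by (simp add: comp_functor_def comp_assoc)

lemma u_natural:
  assumes [simp]: "f \<in> Arr C"
  shows "u (Tgt C f) \<cdot> f = amap P (amap P (amap \<nu> f)) \<cdot> u (Src C f)"
proof (rule mono_cancel[OF \<eta>_P_mono[of "omap P (omap \<nu> (Tgt C f))"]])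
  let ?A = "Src C f" and ?B = "Tgt C f"
  let ?g = "amap P (amap P (amap \<nu> f))"
  have n1: "\<eta> (omap P (omap P (omap \<nu> ?B))) \<cdot> ?g = amap \<nu>' (amap \<nu> ?g) \<cdot> \<eta> (omap P (omap P (omap \<nu> ?A)))"
    using unit_natural[OF adj, of ?g] by simp
  have n2: "amap \<nu> ?g \<cdot> h (omap \<nu> ?A) = h (omap \<nu> ?B) \<cdot> amap \<nu> f"
    using unit_natural[OF adj_P, of "amap \<nu> f"] by simp
  have n3: "amap \<nu>' (amap \<nu> ?g) \<cdot> amap \<nu>' (h (omap \<nu> ?A)) = amap \<nu>' (h (omap \<nu> ?B)) \<cdot> amap \<nu>' (amap \<nu> f)"
    using functor_eq[OF n2, of \<nu>'] by simp
  have "\<eta> (omap P (omap P (omap \<nu> ?B))) \<cdot> (?g \<cdot> u ?A)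
      = amap \<nu>' (amap \<nu> ?g) \<cdot> (amap \<nu>' (h (omap \<nu> ?A)) \<cdot> \<eta> ?A)"
    by (simp add: Comp_eq_Comp[OF n1] \<eta>_u)
  also have "\<dots> = amap \<nu>' (h (omap \<nu> ?B)) \<cdot> (amap \<nu>' (amap \<nu> f) \<cdot> \<eta> ?A)"
    by (simp add: Comp_eq_Comp[OF n3])
  also have "\<dots> = amap \<nu>' (h (omap \<nu> ?B)) \<cdot> (\<eta> ?B \<cdot> f)"
    by (simp add: unit_natural[OF adj])
  also have "\<dots> = \<eta> (omap P (omap P (omap \<nu> ?B))) \<cdot> (u ?B \<cdot> f)"
    by (simp add: Comp_eq_Comp[OF \<eta>_u])
  finally show "\<eta> (omap P (omap P (omap \<nu> ?B))) \<cdot> (u ?B \<cdot> f)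
      = \<eta> (omap P (omap P (omap \<nu> ?B))) \<cdot> (?g \<cdot> u ?A)"
    by simp
qed simp_all

text \<open>
  The counit needs no change: the counit of the composite is \<open>c\<close> precomposed with \<open>P (\<epsilon> \<cdot> \<nu> \<eta>)\<close> at an object
  \<open>P A\<close>, which is the identity.
\<close>

lemma adj_P_\<nu>: "adjunction C (P \<circ>\<^sub>F \<nu>) P u c"
  unfolding adjunction_def
proof (intro conjI ballI)
  show "additive_functor C (P \<circ>\<^sub>F \<nu>)"
    by (rule additive_functor_comp) simp_all
  show "natural_transformation C id_functor (P \<circ>\<^sub>F (P \<circ>\<^sub>F \<nu>)) u"
    unfolding natural_transformation_def using u_natural by (auto simp: id_functor_def Hom_def)
  show "natural_transformation C ((P \<circ>\<^sub>F \<nu>) \<circ>\<^sub>F P) id_functor c"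
    unfolding P_\<nu>_P using adj_P by (simp add: adjunction_def)
  show "additive_functor C P"
    by simp
next
  fix A assume [simp]: "A \<in> Obj C"
  show "c (omap (P \<circ>\<^sub>F \<nu>) A) \<cdot> amap (P \<circ>\<^sub>F \<nu>) (u A) = Ident C (omap (P \<circ>\<^sub>F \<nu>) A)"
    using adjunction_triangles(1)[OF adj_P, of "omap \<nu> A"] by (simp add: \<nu>_u)
  show "amap P (c A) \<cdot> u (omap P A) = Ident C (omap P A)"
  proof (rule mono_cancel[OF \<eta>_P_mono[of A]])
    have n: "\<eta> (omap P A) \<cdot> amap P (c A) = amap \<nu>' (amap \<nu> (amap P (c A))) \<cdot> \<eta> (omap P (omap P (omap \<nu> (omap P A))))"
      using unit_natural[OF adj, of "amap P (c A)"] by simp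
    have t: "amap \<nu> (amap P (c A)) \<cdot> h (omap \<nu> (omap P A)) = Ident C (omap \<nu> (omap P A))"
      using adjunction_triangles(2)[OF adj_P, of A] by simp
    have "\<eta> (omap P A) \<cdot> (amap P (c A) \<cdot> u (omap P A))
        = amap \<nu>' (amap \<nu> (amap P (c A)) \<cdot> h (omap \<nu> (omap P A))) \<cdot> \<eta> (omap P A)"
      by (simp add: Comp_eq_Comp[OF n] \<eta>_u)
    also have "\<dots> = \<eta> (omap P A)"
      unfolding t by simp
    finally show "\<eta> (omap P A) \<cdot> (amap P (c A) \<cdot> u (omap P A)) = \<eta> (omap P A) \<cdot> Ident C (omap P A)"
      by simp
  qed simp_all
qed

text \<open>Every arrow \<open>P A' \<rightarrow> A\<close>, in particular a generating epimorphism, factors through the counit at \<open>A\<close>.\<close>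

lemma epi_c':
  assumes [simp]: "A \<in> Obj C"
  shows "epi_arr C (c A)"
proof -
  obtain A' f where [simp]: "A' \<in> Obj C" and "f \<in> Hom C (omap P A') A" and epi: "epi_arr C f"
    using generating assms unfolding generating_functor_def by blast
  then have [simp]: "f \<in> Arr C" "Src C f = omap P A'" "Tgt C f = A"
    by (auto simp: Hom_def)
  have "c A \<cdot> (amap P (amap (\<nu> \<circ>\<^sub>F P) f) \<cdot> amap P (h A')) = f"
    using transpose_transpose[OF adj_P, of f A'] by simp
  then show ?thesis
    using epi epi_right_factor[of "c A" "amap P (amap (\<nu> \<circ>\<^sub>F P) f) \<cdot> amap P (h A')"] by simp
qed

sublocale adjoint_triple C "P \<circ>\<^sub>F \<nu>" P "\<nu> \<circ>\<^sub>F P" u h c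
  by unfold_locales
    (auto intro: adj_P_\<nu> adj_P epi_c' P_\<nu>_P left_adjoint_cokernel[OF adj] left_adjoint_cokernel[OF adj_P])

lemma resolving_gorenstein_projectives: "resolving C (gorenstein_projectives C P \<nu>)"
proof -
  have "gorenstein_projectives C P \<nu> = {A. S_acyclic A \<and> embedded A}"
    by (rule gorenstein_projectives_eq) (auto intro: left_adjoint_cokernel[OF adj])
  then show ?thesis
    using resolving_S_acyclic_embedded by simp
qed

text \<open>
  In the opposite category the roles of \<open>\<nu>\<close> and \<open>\<nu>'\<close> are exchanged.  The adjoint of \<open>\<nu> \<circ> P\<close> required there
  is \<open>\<nu>' \<circ> \<nu> \<circ> P\<close>, which is \<open>P\<close> up to the isomorphism \<open>\<eta>\<close>; generation becomes the injectivity of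
  \<open>h A : A \<rightarrow> \<nu> (P (P A))\<close>, which holds because \<open>P\<close> is faithful.
\<close>

lemma nakayama_opposite: "\<exists>h' c'. nakayama (opposite C) (\<nu> \<circ>\<^sub>F P) \<nu>' \<nu> \<epsilon> \<eta> h' c'"
proof -
  have add: "additive_functor C (\<nu>' \<circ>\<^sub>F (\<nu> \<circ>\<^sub>F P))"
    by (intro additive_functor_comp) simp_all
  obtain h' c' where adj': "adjunction C (\<nu>' \<circ>\<^sub>F (\<nu> \<circ>\<^sub>F P)) (\<nu> \<circ>\<^sub>F P) c' h'"
  proof -
    have "\<eta> (omap P (Tgt C f)) \<cdot> amap P f = amap (\<nu>' \<circ>\<^sub>F (\<nu> \<circ>\<^sub>F P)) f \<cdot> \<eta> (omap P (Src C f))"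
      if "f \<in> Arr C" for f
      using unit_natural[OF adj, of "amap P f"] that by simp
    then show thesis
      using adjunction_iso_left[OF adj_P add, of "\<lambda>A. \<eta> (omap P A)" \<eta>_inv] that \<eta>_inv
      by simp
  qed
  have "iso_arr C (\<epsilon> (omap \<nu> (omap P A)))" if [simp]: "A \<in> Obj C" for A
    unfolding iso_arr_def
  proof (intro conjI bexI[of _ "amap \<nu> (\<eta> (omap P A))"])
    show "amap \<nu> (\<eta> (omap P A)) \<cdot> \<epsilon> (omap \<nu> (omap P A)) = Ident C (Src C (\<epsilon> (omap \<nu> (omap P A))))"
      using functor_Comp[of \<nu> "\<eta>_inv A" "\<eta> (omap P A)"] by (simp add: \<eta>_inv(5) \<nu>_\<eta>_inv)
  qed (simp_all add: Hom_def adjunction_triangles(1)[OF adj])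
  moreover have "generating_functor (opposite C) (\<nu> \<circ>\<^sub>F P)"
    unfolding generating_functor_def
  proof (intro conjI ballI)
    fix A assume "A \<in> Obj (opposite C)"
    then have [simp]: "A \<in> Obj C"
      by simp
    show "\<exists>A' \<in> Obj (opposite C). \<exists>f \<in> Hom (opposite C) (omap (\<nu> \<circ>\<^sub>F P) A') A. epi_arr (opposite C) f"
      using mono_h[of A] by (intro bexI[of _ "omap P A"] bexI[of _ "h A"]) (simp_all add: Hom_def)
  qed simp
  ultimately have "nakayama (opposite C) (\<nu> \<circ>\<^sub>F P) \<nu>' \<nu> \<epsilon> \<eta> h' c'"
    using abelian_opposite[OF abelian_category_axioms] adjunction_opposite[OF adj] adjunction_opposite[OF adj']
    by (simp add: nakayama_def nakayama_axioms_def)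
  then show ?thesis
    by blast
qed

end

theorem proposition4p1p5:
  fixes C :: "('o, 'm) precategory"
    and P \<nu> \<nu>' I :: "('o, 'm) endofunctor"
    and \<eta> \<epsilon> :: "'o \<Rightarrow> 'm"
  assumes "abelian_category C"
    and "generating_functor C P"
    and "nakayama_functor C P \<nu> \<nu>' \<eta> \<epsilon>"
    and "I = \<nu> \<circ>\<^sub>F P"
  shows "resolving C (gorenstein_projectives C P \<nu>)
    \<and> coresolving C (gorenstein_injectives C I \<nu>')"
proof -
  obtain h c where "nakayama C P \<nu> \<nu>' \<eta> \<epsilon> h c"
    using assms by (auto simp: nakayama_functor_def right_adjoint_to_def nakayama_def nakayama_axioms_def)
  then interpret N: nakayama C P \<nu> \<nu>' \<eta> \<epsilon> h c .
  obtain h' c' where "nakayama (opposite C) I \<nu>' \<nu> \<epsilon> \<eta> h' c'"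
    using N.nakayama_opposite assms(4) by auto
  then have "resolving (opposite C) (gorenstein_projectives (opposite C) I \<nu>')"
    by (rule nakayama.resolving_gorenstein_projectives)
  then have "coresolving C (gorenstein_injectives C I \<nu>')"
    unfolding gorenstein_injectives_eq_opposite[OF assms(1)]
    by (rule coresolving_if_resolving_opposite[OF assms(1)])
  then show ?thesis
    using N.resolving_gorenstein_projectives by blast
qed

end
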